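(* Let $M_1=(E_1,r_1)$ and $M_2=(E_2,r_2)$ be $q$-matroids of rank $k_1$ and $k_2$ respectively, where $E_1=\langle e_1,\dots,e_{n_1}\rangle$ and $E_2=\langle e_{n_1+1},\dots,e_{n_1+n_2}\rangle$ for the standard basis $e_1,\dots,e_{n_1+n_2}$ of $\mathbb{F}_q^{n_1+n_2}$. If $M_1\square M_2$ is $\mathbb{F}_{q^m}$-representable, then $M_1$ and $M_2$ are $\mathbb{F}_{q^m}$-representable, and $M_1\square M_2=M[G]$ for some matrix $$G=\begin{pmatrix}G_1&X\\0&G_2\end{pmatrix},$$ where $G_1\in\mathbb{F}_{q^m}^{k_1\times n_1}$ represents $M_1$, $G_2\in\mathbb{F}_{q^m}^{k_2\times n_2}$ represents $M_2$, and $X\in\mathbb{F}_{q^m}^{k_1\times n_2}$ is such that the number $$\big|\{U\le\mathcal{S}_G:\ \dim_{\mathbb{F}_q}(U)=\dim_{\mathbb{F}_{q^m}}(\langle U\rangle_{\mathbb{F}_{q^m}})\}\big|$$ of such $\mathbb{F}_q$-subspaces $U$ is maximal over all choices of $X\in\mathbb{F}_{q^m}^{k_1\times n_2}$, where $\mathcal{S}_G$ denotes the $\mathbb{F}_q$-span of the columns of $G$.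
   Context: For a finite-dimensional $\mathbb{F}_q$-space $E$, $\mathcal{L}(E)$ is its subspace lattice. A $q$-matroid $M=(E,r)$ is given by $r:\mathcal{L}(E)\to\mathbb{Z}$ with (R1) $0\le r(A)\le\dim(A)$; (R2) $A\le B\Rightarrow r(A)\le r(B)$; (R3) $r(A+B)+r(A\cap B)\le r(A)+r(B)$; its rank is $r(E)$. $A$ is independent if $r(A)=\dim A$. For $G\in\mathbb{F}_{q^m}^{k\times n}$, $M[G]$ is the $q$-matroid on $\mathbb{F}_q^n$ with rank function $U\mapsto\mathrm{rk}(GA^U)$, where $A^U$ is a matrix whose columns form an $\mathbb{F}_q$-basis of $U$. A $q$-matroid of rank $k$ on $\mathbb{F}_q^n$ is $\mathbb{F}_{q^m}$-representable if it equals $M[G]$ for some full rank $G\in\mathbb{F}_{q^m}^{k\times n}$ (then $G$ represents it). $E_1$ and $E_2$ are identified with $\mathbb{F}_q^{n_1}$ and $\mathbb{F}_q^{n_2}$ via the given bases, and $\mathbb{F}_q^{n_1+n_2}=E_1\oplus E_2$. Free product: with projections $\pi_i:E_1\oplus E_2\to E_i$ and embeddings $\iota_i:E_i\to E_1\oplus E_2$, put $\lambda_1(A)=r_1(E_1)-r_1(A)$ and $\nu_2(B)=\dim(B)-r_2(B)$. $M_1\square M_2$ is the $q$-matroid on $E_1\oplus E_2$ whose independent spaces are exactly the $I\le E_1\oplus E_2$ with $\pi_1(I\cap\iota_1(E_1))$ independent in $M_1$ and $\lambda_1(\pi_1(I\cap\iota_1(E_1)))\ge\nu_2(\pi_2(I))$.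 *)

theory Defs
  imports "Jordan_Normal_Form.DL_Rank"
begin

text \<open>The ground field \<open>F\<^sub>q\<close> is a finite field type \<open>'q\<close>, the extension field is a finite
  field type \<open>'k\<close>, and the inclusion is a field homomorphism \<open>h :: 'q \<Rightarrow> 'k\<close>.
  \<open>F\<^sub>q\<^sup>n\<close> is \<open>module_vec TYPE('q) n\<close>, with carrier \<open>carrier_vec n\<close>.\<close>

abbreviation vs_dim :: "('a::field, 'v, 'c) module_scheme \<Rightarrow> nat" where
  "vs_dim V \<equiv> vectorspace.dim class_ring V"

definition subspaces :: "nat \<Rightarrow> 'a::field vec set set" where
  "subspaces n = {U. subspace class_ring U (module_vec TYPE('a) n)}"

definition sdim :: "nat \<Rightarrow> 'a::field vec set \<Rightarrow> nat" where
  "sdim n U = vs_dim (module_vec TYPE('a) n \<lparr>carrier := U\<rparr>)"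

definition ssum :: "nat \<Rightarrow> 'a::field vec set \<Rightarrow> 'a vec set \<Rightarrow> 'a vec set" where
  "ssum n A B = module.submodule_sum (module_vec TYPE('a) n) A B"

text \<open>A \<open>q\<close>-matroid on \<open>F\<^sub>q\<^sup>n\<close> is given by its rank function; only the values of \<open>r\<close> on subspaces
  are meaningful, so equality of \<open>q\<close>-matroids is equality on \<open>subspaces n\<close>.\<close>

definition qmatroid :: "nat \<Rightarrow> ('q::{field,finite} vec set \<Rightarrow> int) \<Rightarrow> bool" where
  "qmatroid n r \<longleftrightarrow>
     (\<forall>A \<in> subspaces n. 0 \<le> r A \<and> r A \<le> int (sdim n A)) \<and>
     (\<forall>A \<in> subspaces n. \<forall>B \<in> subspaces n. A \<subseteq> B \<longrightarrow> r A \<le> r B) \<and>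
     (\<forall>A \<in> subspaces n. \<forall>B \<in> subspaces n. r (ssum n A B) + r (A \<inter> B) \<le> r A + r B)"

definition qmatroid_eq ::
  "nat \<Rightarrow> ('q::{field,finite} vec set \<Rightarrow> int) \<Rightarrow> ('q vec set \<Rightarrow> int) \<Rightarrow> bool" where
  "qmatroid_eq n r r' \<longleftrightarrow> (\<forall>U \<in> subspaces n. r U = r' U)"

definition qrank :: "nat \<Rightarrow> ('q::{field,finite} vec set \<Rightarrow> int) \<Rightarrow> int" where
  "qrank n r = r (carrier_vec n)"

definition qindep :: "nat \<Rightarrow> ('q::{field,finite} vec set \<Rightarrow> int) \<Rightarrow> 'q vec set \<Rightarrow> bool" where
  "qindep n r A \<longleftrightarrow> A \<in> subspaces n \<and> r A = int (sdim n A)"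

definition basis_matrix :: "nat \<Rightarrow> 'q::{field,finite} vec set \<Rightarrow> 'q mat \<Rightarrow> bool" where
  "basis_matrix n U A \<longleftrightarrow> dim_row A = n \<and> distinct (cols A) \<and>
     vectorspace.basis class_ring (module_vec TYPE('q) n \<lparr>carrier := U\<rparr>) (set (cols A))"

definition matrix_qmatroid ::
  "('q::{field,finite} \<Rightarrow> 'k::{field,finite}) \<Rightarrow> 'k mat \<Rightarrow> 'q vec set \<Rightarrow> int" where
  "matrix_qmatroid h G U =
     int (vec_space.rank (dim_row G) (G * map_mat h (SOME A. basis_matrix (dim_col G) U A)))"

definition represents ::
  "('q::{field,finite} \<Rightarrow> 'k::{field,finite}) \<Rightarrow> nat \<Rightarrow> nat \<Rightarrow> 'k mat \<Rightarrow> ('q vec set \<Rightarrow> int) \<Rightarrow> bool" where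
  "represents h k n G r \<longleftrightarrow> G \<in> carrier_mat k n \<and> vec_space.rank k G = k \<and>
     qmatroid_eq n r (matrix_qmatroid h G)"

definition representable ::
  "('q::{field,finite} \<Rightarrow> 'k::{field,finite}) \<Rightarrow> nat \<Rightarrow> ('q vec set \<Rightarrow> int) \<Rightarrow> bool" where
  "representable h n r \<longleftrightarrow> (\<exists>k G. int k = qrank n r \<and> represents h k n G r)"

text \<open>\<open>F\<^sub>q\<^bsup>n\<^sub>1+n\<^sub>2\<^esup> = E\<^sub>1 \<oplus> E\<^sub>2\<close>, where \<open>E\<^sub>1\<close> and \<open>E\<^sub>2\<close> consist of the first \<open>n\<^sub>1\<close> and the last \<open>n\<^sub>2\<close>
  coordinates.  Thus \<open>\<pi>\<^sub>1\<close>, \<open>\<pi>\<^sub>2\<close> are \<open>vec_first\<close>, \<open>vec_last\<close>.\<close>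

definition emb1 :: "nat \<Rightarrow> 'q::{field,finite} vec \<Rightarrow> 'q vec" where
  "emb1 n2 v = v @\<^sub>v 0\<^sub>v n2"

definition colevel :: "nat \<Rightarrow> ('q::{field,finite} vec set \<Rightarrow> int) \<Rightarrow> 'q vec set \<Rightarrow> int" where
  "colevel n r A = r (carrier_vec n) - r A"

definition nullity :: "nat \<Rightarrow> ('q::{field,finite} vec set \<Rightarrow> int) \<Rightarrow> 'q vec set \<Rightarrow> int" where
  "nullity n r B = int (sdim n B) - r B"

definition free_product_indep ::
  "nat \<Rightarrow> nat \<Rightarrow> ('q::{field,finite} vec set \<Rightarrow> int) \<Rightarrow> ('q vec set \<Rightarrow> int) \<Rightarrow> 'q vec set \<Rightarrow> bool" where
  "free_product_indep n1 n2 r1 r2 I \<longleftrightarrow>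
     (let I1 = (\<lambda>v. vec_first v n1) ` (I \<inter> emb1 n2 ` carrier_vec n1);
          I2 = (\<lambda>v. vec_last v n2) ` I
      in qindep n1 r1 I1 \<and> colevel n1 r1 I1 \<ge> nullity n2 r2 I2)"

text \<open>\<open>r\<close> is (the rank function of) the free product of \<open>r1\<close> and \<open>r2\<close>.  A \<open>q\<close>-matroid is
  determined by its independent spaces, so this pins down \<open>r\<close> on \<open>subspaces (n1 + n2)\<close>.\<close>

definition is_free_product ::
  "nat \<Rightarrow> nat \<Rightarrow> ('q::{field,finite} vec set \<Rightarrow> int) \<Rightarrow> ('q vec set \<Rightarrow> int) \<Rightarrow>
     ('q vec set \<Rightarrow> int) \<Rightarrow> bool" where
  "is_free_product n1 n2 r1 r2 r \<longleftrightarrow> qmatroid (n1 + n2) r \<and>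
     (\<forall>I \<in> subspaces (n1 + n2). qindep (n1 + n2) r I \<longleftrightarrow> free_product_indep n1 n2 r1 r2 I)"

text \<open>Column vectors over \<open>'k\<close> as a vector space over \<open>'q\<close>, by restriction of scalars along \<open>h\<close>.\<close>

definition restricted_vec ::
  "('q::{field,finite} \<Rightarrow> 'k::{field,finite}) \<Rightarrow> nat \<Rightarrow> ('q, 'k vec) module" where
  "restricted_vec h k = \<lparr>carrier = carrier_vec k, mult = undefined, one = undefined,
     zero = 0\<^sub>v k, add = (+), smult = (\<lambda>c v. h c \<cdot>\<^sub>v v)\<rparr>"

lemma vectorspace_restricted_vec:
  assumes "field_hom h"
  shows "vectorspace class_ring (restricted_vec h k)"
proof -
  interpret h: field_hom h by fact
  interpret K: vec_space "TYPE('b)" k .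
  show ?thesis
    unfolding vectorspace_def restricted_vec_def
    apply (intro conjI class_field.field_axioms)
    apply (rule moduleI)
    apply (rule class_cring.cring_axioms)
    apply (rule abelian_groupI)
    apply (auto simp: h.hom_add h.hom_mult add_smult_distrib_vec smult_add_distrib_vec
        smult_smult_assoc intro!: bexI[of _ "- x" for x])
    done
qed

definition col_span :: "('q::{field,finite} \<Rightarrow> 'k::{field,finite}) \<Rightarrow> 'k mat \<Rightarrow> 'k vec set" where
  "col_span h G =
     LinearCombinations.module.span class_ring (restricted_vec h (dim_row G)) (set (cols G))"

definition dim_preserved_subspaces ::
  "('q::{field,finite} \<Rightarrow> 'k::{field,finite}) \<Rightarrow> 'k mat \<Rightarrow> 'k vec set set" where
  "dim_preserved_subspaces h G =
     {U. subspace class_ring U (restricted_vec h (dim_row G)) \<and> U \<subseteq> col_span h G \<and>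
         vs_dim (restricted_vec h (dim_row G) \<lparr>carrier := U\<rparr>) =
         sdim (dim_row G)
           (LinearCombinations.module.span class_ring (module_vec TYPE('k) (dim_row G)) U)}"

definition block_upper :: "'k::field mat \<Rightarrow> 'k mat \<Rightarrow> 'k mat \<Rightarrow> 'k mat" where
  "block_upper G1 X G2 = four_block_mat G1 X (0\<^sub>m (dim_row G2) (dim_col G1)) G2"

end

theory Submission
  imports Defs "HOL-Library.Cardinality"
begin

text \<open>
  Independent spaces of the free product are the freest possible: a space \<open>I\<close> that is independent
  in any \<open>q\<close>-matroid whose restriction to \<open>E\<^sub>1\<close> is \<open>M\<^sub>1\<close> and whose contraction by \<open>E\<^sub>1\<close> is \<open>M\<^sub>2\<close>
  satisfies \<open>dim I \<le> k\<^sub>1 + r\<^sub>2 (\<pi>\<^sub>2 I)\<close>, which is the defining inequality of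
  the free product.  A representing matrix becomes block upper triangular in a basis of the column space
  adapted to the span of the first \<open>n\<^sub>1\<close> columns, and its diagonal blocks represent the
  restriction and the contraction, that is, \<open>M\<^sub>1\<close> and \<open>M\<^sub>2\<close>.  Replacing \<open>X\<close> by any \<open>X'\<close> keeps these
  two minors, so every independent space of \<open>M[G']\<close> stays independent in \<open>M[G]\<close>.  The columns may
  be dependent over \<open>F\<^sub>q\<close>; choosing a complement \<open>C\<close> of the kernel of \<open>x \<mapsto> G' x\<close> identifies the
  subspaces counted for \<open>G'\<close> with the independent spaces of \<open>M[G']\<close> inside \<open>C\<close>, and \<open>x \<mapsto> G x\<close> maps
  these injectively to subspaces counted for \<open>G\<close>.
\<close>

section \<open>Dimension and cardinality\<close>

text \<open>All fields are finite, so a dimension is the logarithm of a cardinality.  This lets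
  \<open>F\<^sub>q\<close>-spaces and spaces over the extension field be compared without choosing bases.\<close>

lemma card_carrier_vec: "card (carrier_vec n :: 'a::finite vec set) = CARD('a) ^ n"
proof -
  have "bij_betw list_of_vec (carrier_vec n :: 'a vec set) {xs. set xs \<subseteq> UNIV \<and> length xs = n}"
  proof (rule bij_betw_byWitness[where f' = vec_of_list])
    show "\<forall>v\<in>carrier_vec n. vec_of_list (list_of_vec v) = (v :: 'a vec)" by (simp add: vec_list)
    show "\<forall>xs\<in>{xs. set xs \<subseteq> UNIV \<and> length xs = n}. list_of_vec (vec_of_list xs) = (xs :: 'a list)"
      by (simp add: list_vec)
    show "list_of_vec ` (carrier_vec n :: 'a vec set) \<subseteq> {xs. set xs \<subseteq> UNIV \<and> length xs = n}"
      by (intro image_subsetI) simp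
    show "vec_of_list ` {xs. set xs \<subseteq> UNIV \<and> length xs = n} \<subseteq> (carrier_vec n :: 'a vec set)"
      by (intro image_subsetI carrier_vecI) simp
  qed
  from bij_betw_same_card[OF this] show ?thesis
    by (simp only: card_lists_length_eq[OF finite])
qed

lemma finite_carrier_vec: "finite (carrier_vec n :: 'a::finite vec set)"
proof (rule card_ge_0_finite)
  show "0 < card (carrier_vec n :: 'a vec set)"
    unfolding card_carrier_vec by (simp only: zero_less_power zero_less_card_finite)
qed

lemma field_card_gt_1: "CARD('a::{field,finite}) > 1"
proof -
  have "card {0, 1 :: 'a} \<le> CARD('a)" by (rule card_mono) auto
  then show ?thesis by simp
qed

text \<open>A finite carrier generates itself, so the space has a finite basis. Coordinates then
  identify the carrier with the extensional functions from that basis to the field.\<close>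

lemma vectorspace_card_eq_power_dim:
  fixes V :: "('a::{field,finite}, 'v, 'c) module_scheme"
  assumes "vectorspace class_ring V" and "finite (carrier V)"
  shows "card (carrier V) = CARD('a) ^ vs_dim V"
proof -
  interpret vectorspace class_ring V by fact
  have "gen_set (carrier V)"
    using in_own_span[of "carrier V"] span_is_subset2[of "carrier V"] by blast
  then have "fin_dim" unfolding fin_dim_def using assms(2) by blast
  then obtain B where B: "finite B" "basis B" using finite_basis_exists by blast
  then have BC: "B \<subseteq> carrier V" by (simp add: basis_def)
  have crit: "\<forall>v. v \<in> carrier V \<longrightarrow> (\<exists>!a. a \<in> B \<rightarrow>\<^sub>E UNIV \<and> lincomb a B = v)"
    using basis_criterion[OF B(1) BC] B(2) by simp
  have lc: "lincomb a B \<in> carrier V" for a using BC by (intro lincomb_closed) auto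
  have "bij_betw (\<lambda>a. lincomb a B) (B \<rightarrow>\<^sub>E UNIV) (carrier V)"
  proof (intro bij_betw_imageI inj_onI subset_antisym subsetI)
    fix a b assume "a \<in> B \<rightarrow>\<^sub>E UNIV" "b \<in> B \<rightarrow>\<^sub>E UNIV" "lincomb a B = lincomb b B"
    then show "a = b" using crit lc[of a] by metis
  next
    fix v assume "v \<in> carrier V"
    then obtain a where "a \<in> B \<rightarrow>\<^sub>E UNIV" "lincomb a B = v" using crit by blast
    then show "v \<in> (\<lambda>a. lincomb a B) ` (B \<rightarrow>\<^sub>E UNIV)" by blast
  next
    fix v assume "v \<in> (\<lambda>a. lincomb a B) ` (B \<rightarrow>\<^sub>E UNIV)"
    then show "v \<in> carrier V" using lc by blast
  qed
  then have "card (carrier V) = card (B \<rightarrow>\<^sub>E (UNIV :: 'a set))" by (simp add: bij_betw_same_card)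
  then show ?thesis by (simp add: card_PiE B dim_basis[OF B])
qed

section \<open>Subspaces and dimensions over the ground field\<close>

definition hsubspaces :: "('q::{field,finite} \<Rightarrow> 'k::{field,finite}) \<Rightarrow> nat \<Rightarrow> 'k vec set set" where
  "hsubspaces h k = {U. subspace class_ring U (restricted_vec h k)}"

definition hdim :: "('q::{field,finite} \<Rightarrow> 'k::{field,finite}) \<Rightarrow> nat \<Rightarrow> 'k vec set \<Rightarrow> nat" where
  "hdim h k U = vs_dim (restricted_vec h k \<lparr>carrier := U\<rparr>)"

lemma mem_hsubspaces:
  assumes "field_hom h"
  shows "U \<in> hsubspaces h k \<longleftrightarrow> U \<subseteq> carrier_vec k \<and> 0\<^sub>v k \<in> U \<and>
    (\<forall>u\<in>U. \<forall>v\<in>U. u + v \<in> U) \<and> (\<forall>c. \<forall>u\<in>U. h c \<cdot>\<^sub>v u \<in> U)"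
proof -
  have "vectorspace class_ring (restricted_vec h k)" "module class_ring (restricted_vec h k)"
    using vectorspace_restricted_vec[OF assms, of k] by (simp_all add: vectorspace_def)
  then show ?thesis
    unfolding hsubspaces_def subspace_def submodule_def mem_Collect_eq
    by (simp add: restricted_vec_def) blast
qed

lemma mem_subspaces:
  "U \<in> subspaces n \<longleftrightarrow> U \<subseteq> carrier_vec n \<and> 0\<^sub>v n \<in> U \<and>
    (\<forall>u\<in>U. \<forall>v\<in>U. u + v \<in> U) \<and> (\<forall>c. \<forall>u\<in>U. c \<cdot>\<^sub>v u \<in> U)"
  unfolding subspaces_def subspace_def submodule_def mem_Collect_eq
  by (simp add: vec_vs vec_module module_vec_simps) blast

lemma field_hom_id: "field_hom (\<lambda>x. x)"
  by unfold_locales auto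

text \<open>The identity is a field homomorphism, so every fact about \<open>hsubspaces\<close>
  specialises to ordinary subspaces. One development thus serves both scalar fields.\<close>

lemma subspaces_eq_hsubspaces: "subspaces n = hsubspaces (\<lambda>x. x) n"
  unfolding set_eq_iff by (simp add: mem_subspaces mem_hsubspaces[OF field_hom_id])

lemma finite_hsubspace:
  assumes "field_hom h" and "U \<in> hsubspaces h k"
  shows "finite U"
  using assms(2) finite_subset[OF _ finite_carrier_vec]
  unfolding mem_hsubspaces[OF assms(1)] by blast

lemma card_hsubspace:
  fixes h :: "'q::{field,finite} \<Rightarrow> 'k::{field,finite}"
  assumes "field_hom h" and "U \<in> hsubspaces h k"
  shows "card U = CARD('q) ^ hdim h k U"
proof -
  interpret vectorspace class_ring "restricted_vec h k" by (rule vectorspace_restricted_vec) fact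
  have "vectorspace class_ring (restricted_vec h k \<lparr>carrier := U\<rparr>)"
    using subspace_is_vs assms(2) by (simp add: hsubspaces_def)
  from vectorspace_card_eq_power_dim[OF this] finite_hsubspace[OF assms]
  show ?thesis unfolding hdim_def by simp
qed

lemma card_subspace:
  fixes U :: "'a::{field,finite} vec set"
  assumes "U \<in> subspaces n"
  shows "card U = CARD('a) ^ sdim n U"
proof -
  interpret vectorspace class_ring "module_vec TYPE('a) n" by (rule vec_vs)
  have "vectorspace class_ring (module_vec TYPE('a) n \<lparr>carrier := U\<rparr>)"
    using subspace_is_vs assms by (simp add: subspaces_def)
  from vectorspace_card_eq_power_dim[OF this] finite_hsubspace[OF field_hom_id assms[unfolded subspaces_eq_hsubspaces]]
  show ?thesis unfolding sdim_def by simp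
qed

text \<open>The two dimensions are taken in separately defined module records. Each is the logarithm
  of the same cardinality, so the records need not be compared.\<close>

lemma hdim_id_eq_sdim:
  fixes U :: "'a::{field,finite} vec set"
  assumes "U \<in> subspaces n"
  shows "hdim (\<lambda>x. x) n U = sdim n U"
proof -
  have "CARD('a) ^ hdim (\<lambda>x. x) n U = CARD('a) ^ sdim n U"
    using card_subspace[OF assms] card_hsubspace[OF field_hom_id, of U n] assms
    by (simp only: subspaces_eq_hsubspaces)
  then show ?thesis using power_inject_exp[OF field_card_gt_1] by blast
qed

lemma hsubspaceD:
  assumes "field_hom h" and "U \<in> hsubspaces h k"
  shows "U \<subseteq> carrier_vec k" and "0\<^sub>v k \<in> U"
    and "\<And>u v. u \<in> U \<Longrightarrow> v \<in> U \<Longrightarrow> u + v \<in> U"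
    and "\<And>c u. u \<in> U \<Longrightarrow> h c \<cdot>\<^sub>v u \<in> U"
    and "\<And>u v. u \<in> U \<Longrightarrow> v \<in> U \<Longrightarrow> u - v \<in> U"
proof -
  interpret field_hom h by fact
  note U = assms(2)[unfolded mem_hsubspaces[OF assms(1)]]
  then show C: "U \<subseteq> carrier_vec k" and "0\<^sub>v k \<in> U"
    and A: "\<And>u v. u \<in> U \<Longrightarrow> v \<in> U \<Longrightarrow> u + v \<in> U"
    and S: "\<And>c u. u \<in> U \<Longrightarrow> h c \<cdot>\<^sub>v u \<in> U" by blast+
  fix u v assume uv: "u \<in> U" "v \<in> U"
  then have "u - v = u + h (- 1) \<cdot>\<^sub>v v" using C by (auto simp: hom_uminus intro!: eq_vecI)
  then show "u - v \<in> U" using A S uv by simp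
qed

lemma subspaceD:
  assumes "U \<in> subspaces k"
  shows "U \<subseteq> carrier_vec k" and "0\<^sub>v k \<in> U"
    and "\<And>u v. u \<in> U \<Longrightarrow> v \<in> U \<Longrightarrow> u + v \<in> U"
    and "\<And>c u. u \<in> U \<Longrightarrow> c \<cdot>\<^sub>v u \<in> U"
  using assms unfolding mem_subspaces by blast+

lemma hdim_mono:
  assumes "field_hom h" "U \<in> hsubspaces h k" "W \<in> hsubspaces h k" "U \<subseteq> W"
  shows "hdim h k U \<le> hdim h k W"
  using card_mono[OF finite_hsubspace[OF assms(1,3)] assms(4)]
  unfolding card_hsubspace[OF assms(1,2)] card_hsubspace[OF assms(1,3)]
  using power_le_imp_le_exp[OF field_card_gt_1] by blast

lemma sdim_mono:
  fixes U W :: "'a::{field,finite} vec set"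
  assumes "U \<in> subspaces k" "W \<in> subspaces k" "U \<subseteq> W"
  shows "sdim k U \<le> sdim k W"
  using hdim_mono[OF field_hom_id, of U k W] assms
  by (simp add: hdim_id_eq_sdim subspaces_eq_hsubspaces[symmetric])

lemma hsubspace_eqI:
  assumes "field_hom h" "U \<in> hsubspaces h k" "W \<in> hsubspaces h k" "U \<subseteq> W"
    "hdim h k W \<le> hdim h k U"
  shows "U = W"
proof -
  have "hdim h k W = hdim h k U" using hdim_mono[OF assms(1-4)] assms(5) by simp
  then show ?thesis
    using card_subset_eq[OF finite_hsubspace[OF assms(1,3)] assms(4)]
    unfolding card_hsubspace[OF assms(1,2)] card_hsubspace[OF assms(1,3)] by simp
qed

lemma subspace_eqI:
  fixes U W :: "'a::{field,finite} vec set"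
  assumes "U \<in> subspaces k" "W \<in> subspaces k" "U \<subseteq> W" "sdim k W \<le> sdim k U"
  shows "U = W"
  using hsubspace_eqI[OF field_hom_id, of U k W] assms
  by (simp add: hdim_id_eq_sdim subspaces_eq_hsubspaces[symmetric])

section \<open>Adjoining one vector to a subspace\<close>

definition adjoin :: "('q::{field,finite} \<Rightarrow> 'k::{field,finite}) \<Rightarrow> 'k vec set \<Rightarrow> 'k vec \<Rightarrow> 'k vec set"
  where "adjoin h U v = (\<lambda>(u, c). u + h c \<cdot>\<^sub>v v) ` (U \<times> UNIV)"

lemma adjoin_hsubspace:
  assumes "field_hom h" "U \<in> hsubspaces h k" "v \<in> carrier_vec k"
  shows "adjoin h U v \<in> hsubspaces h k" and "U \<subseteq> adjoin h U v" and "v \<in> adjoin h U v"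
proof -
  interpret field_hom h by fact
  note U = hsubspaceD[OF assms(1,2)]
  have eq: "(u + h c \<cdot>\<^sub>v v) + (u' + h c' \<cdot>\<^sub>v v) = (u + u') + h (c + c') \<cdot>\<^sub>v v"
    "h d \<cdot>\<^sub>v (u + h c \<cdot>\<^sub>v v) = h d \<cdot>\<^sub>v u + h (d * c) \<cdot>\<^sub>v v"
    if "u \<in> U" "u' \<in> U" for u u' c c' d
    using that assms(3) U(1)
    by (auto simp: hom_add hom_mult algebra_simps subset_iff intro!: eq_vecI)
  have in1: "u + h c \<cdot>\<^sub>v v \<in> adjoin h U v" if "u \<in> U" for u c
    using that unfolding adjoin_def by force
  have eq0: "u + h 0 \<cdot>\<^sub>v v = u" if "u \<in> U" for u
    using that assms(3) U(1) by (auto intro!: eq_vecI simp: subset_iff)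
  show sub: "U \<subseteq> adjoin h U v"
    using in1[of _ 0] eq0 by force
  have "0\<^sub>v k + h 1 \<cdot>\<^sub>v v = v" using assms(3) by auto
  then show "v \<in> adjoin h U v" using in1[OF U(2), of 1] by simp
  show "adjoin h U v \<in> hsubspaces h k"
    unfolding mem_hsubspaces[OF assms(1)]
  proof (intro conjI ballI allI)
    show "adjoin h U v \<subseteq> carrier_vec k" using U(1) assms(3) by (auto simp: adjoin_def)
    show "0\<^sub>v k \<in> adjoin h U v" using U(2) sub by blast
  next
    fix a b assume "a \<in> adjoin h U v" "b \<in> adjoin h U v"
    then obtain u u' c c' where "u \<in> U" "u' \<in> U" "a = u + h c \<cdot>\<^sub>v v" "b = u' + h c' \<cdot>\<^sub>v v"
      unfolding adjoin_def by auto
    then show "a + b \<in> adjoin h U v" using in1[of "u + u'" "c + c'"] U(3) eq by simp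
  next
    fix d a assume "a \<in> adjoin h U v"
    then obtain u c where "u \<in> U" "a = u + h c \<cdot>\<^sub>v v" unfolding adjoin_def by auto
    then show "h d \<cdot>\<^sub>v a \<in> adjoin h U v" using in1[of "h d \<cdot>\<^sub>v u" "d * c"] U(4) eq(2) by simp
  qed
qed

lemma adjoin_least:
  assumes "field_hom h" "W \<in> hsubspaces h k" "U \<subseteq> W" "v \<in> W"
  shows "adjoin h U v \<subseteq> W"
  using hsubspaceD[OF assms(1,2)] assms(3,4) by (auto simp: adjoin_def)

text \<open>If \<open>v\<close> lies outside \<open>U\<close>, the parametrisation by pairs in
  \<open>U \<times> UNIV\<close> is injective: two representations with different coefficients of
  \<open>v\<close> could be solved for \<open>v\<close> inside \<open>U\<close>. The cardinality is
  therefore multiplied by that of the ground field, and the dimension grows by one.\<close>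

lemma hdim_adjoin:
  fixes h :: "'q::{field,finite} \<Rightarrow> 'k::{field,finite}"
  assumes "field_hom h" "U \<in> hsubspaces h k" "v \<in> carrier_vec k" "v \<notin> U"
  shows "hdim h k (adjoin h U v) = Suc (hdim h k U)"
proof -
  interpret field_hom h by fact
  note U = hsubspaceD[OF assms(1,2)]
  have "inj_on (\<lambda>(u, c). u + h c \<cdot>\<^sub>v v) (U \<times> UNIV)"
  proof (rule inj_onI, clarify)
    fix u u' c c' assume uu: "u \<in> U" "u' \<in> U" and eq: "u + h c \<cdot>\<^sub>v v = u' + h c' \<cdot>\<^sub>v v"
    have C: "u \<in> carrier_vec k" "u' \<in> carrier_vec k" using uu U(1) by auto
    have pt: "u $ i + h c * v $ i = u' $ i + h c' * v $ i" if "i < k" for i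
      using arg_cong[OF eq, of "\<lambda>w. w $ i"] that C assms(3) by simp
    have "c = c'"
    proof (rule ccontr)
      assume "c \<noteq> c'"
      then have nz: "h c - h c' \<noteq> 0" by (simp flip: hom_minus)
      have "h (inverse (c - c')) \<cdot>\<^sub>v (u' - u) = v"
      proof (rule eq_vecI)
        fix i assume "i < dim_vec v"
        then have i: "i < k" using assms(3) by simp
        have "(h c - h c') * v $ i = u' $ i - u $ i" using pt[OF i] by (simp add: algebra_simps)
        then have "h (inverse (c - c')) * (u' $ i - u $ i) = inverse (h c - h c') * ((h c - h c') * v $ i)"
          by (simp only: hom_inverse hom_minus)
        also have "\<dots> = v $ i" using nz by (simp del: right_diff_distrib left_diff_distrib flip: mult.assoc)
        finally show "(h (inverse (c - c')) \<cdot>\<^sub>v (u' - u)) $ i = v $ i"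
          using i C by simp
      qed (use C assms(3) in auto)
      then show False using assms(4) U(4)[OF U(5)[OF uu(2,1)]] by metis
    qed
    moreover from this pt have "u = u'" using C by (intro eq_vecI) auto
    ultimately show "u = u' \<and> c = c'" by simp
  qed
  then have "card (adjoin h U v) = card U * CARD('q)"
    unfolding adjoin_def by (simp add: card_image card_cartesian_product)
  then have "CARD('q) ^ hdim h k (adjoin h U v) = CARD('q) ^ Suc (hdim h k U)"
    using card_hsubspace[OF assms(1) adjoin_hsubspace(1)[OF assms(1-3)]]
      card_hsubspace[OF assms(1,2)] by simp
  then show ?thesis using power_inject_exp[OF field_card_gt_1] by blast
qed

lemma hdim_adjoin_le:
  assumes "field_hom h" "U \<in> hsubspaces h k" "v \<in> carrier_vec k"
  shows "hdim h k (adjoin h U v) \<le> Suc (hdim h k U)"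
proof (cases "v \<in> U")
  case True
  then have "adjoin h U v \<subseteq> U" by (intro adjoin_least[OF assms(1,2)]) auto
  then show ?thesis using hdim_mono[OF assms(1) adjoin_hsubspace(1)[OF assms] assms(2)] by simp
qed (simp add: hdim_adjoin[OF assms])

section \<open>Spans over the field of the vector entries\<close>

abbreviation gspan :: "nat \<Rightarrow> 'a::field vec set \<Rightarrow> 'a vec set" where
  "gspan k S \<equiv> LinearCombinations.module.span class_ring (module_vec TYPE('a) k) S"

lemma gspan_subspace: "S \<subseteq> carrier_vec k \<Longrightarrow> gspan k S \<in> subspaces k"
  for S :: "'a::field vec set"
proof -
  assume S: "S \<subseteq> carrier_vec k"
  interpret vec_space "TYPE('a)" k .
  show ?thesis using span_is_subspace[OF S] by (simp add: subspaces_def)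
qed

lemma subset_gspan: "S \<subseteq> carrier_vec k \<Longrightarrow> S \<subseteq> gspan k S"
  for S :: "'a::field vec set"
proof -
  assume S: "S \<subseteq> carrier_vec k"
  interpret vec_space "TYPE('a)" k .
  show ?thesis using in_own_span[OF S] .
qed

lemma gspan_least: "W \<in> subspaces k \<Longrightarrow> S \<subseteq> W \<Longrightarrow> gspan k S \<subseteq> W"
  for S :: "'a::field vec set"
proof -
  assume W: "W \<in> subspaces k" and S: "S \<subseteq> W"
  interpret vec_space "TYPE('a)" k .
  show ?thesis using span_is_subset[OF S] W by (simp add: subspaces_def subspace_def)
qed

lemma gspan_mono: "S \<subseteq> T \<Longrightarrow> T \<subseteq> carrier_vec k \<Longrightarrow> gspan k S \<subseteq> gspan k T"
  by (meson gspan_least gspan_subspace order_trans subset_gspan)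

lemma subspace_hsubspace:
  "field_hom h \<Longrightarrow> W \<in> subspaces k \<Longrightarrow> W \<in> hsubspaces h k"
  by (simp add: mem_hsubspaces mem_subspaces)

text \<open>Each vector adjoined to \<open>J\<close> on the way to \<open>U\<close> raises the \<open>q\<close>-dimension by exactly one and
  the dimension of the span by at most one.\<close>

lemma sdim_gspan_le:
  fixes h :: "'q::{field,finite} \<Rightarrow> 'k::{field,finite}"
  assumes h: "field_hom h" and U: "U \<in> hsubspaces h k"
  shows "J \<in> hsubspaces h k \<Longrightarrow> J \<subseteq> U \<Longrightarrow>
    sdim k (gspan k U) + hdim h k J \<le> sdim k (gspan k J) + hdim h k U"
proof (induction "hdim h k U - hdim h k J" arbitrary: J rule: less_induct)
  case less
  note J = less.prems
  show ?case
  proof (cases "J = U")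
    case False
    then obtain v where v: "v \<in> U" "v \<notin> J" using J by blast
    have C: "v \<in> carrier_vec k" "J \<subseteq> carrier_vec k"
      using hsubspaceD(1)[OF h U] J(2) v by auto
    let ?J = "adjoin h J v"
    have J': "?J \<in> hsubspaces h k" "?J \<subseteq> U"
      using adjoin_hsubspace(1)[OF h J(1) C(1)] adjoin_least[OF h U J(2) v(1)] .
    have d: "hdim h k ?J = Suc (hdim h k J)" using hdim_adjoin[OF h J(1) C(1) v(2)] .
    then have "sdim k (gspan k U) + hdim h k ?J \<le> sdim k (gspan k ?J) + hdim h k U"
      using hdim_mono[OF h J'(1) U J'(2)] by (intro less.hyps J') simp
    moreover
    \<comment> \<open>Here \<open>v\<close> is adjoined over the extension field. The result
      contains \<open>?J\<close>, because each \<open>h c\<close> is also a scalar of that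
      field.\<close>
    let ?S = "adjoin (\<lambda>x. x) (gspan k J) v"
    have S: "gspan k J \<in> subspaces k" "?S \<in> subspaces k" "gspan k J \<subseteq> ?S" "v \<in> ?S"
      using adjoin_hsubspace[OF field_hom_id, of "gspan k J" k v] gspan_subspace[OF C(2)] C(1)
      by (simp_all add: subspaces_eq_hsubspaces)
    then have "?J \<subseteq> ?S"
      using subset_gspan[OF C(2)] by (intro adjoin_least[OF h subspace_hsubspace[OF h S(2)]]) auto
    then have "gspan k ?J \<subseteq> ?S" by (intro gspan_least S)
    then have "sdim k (gspan k ?J) \<le> sdim k ?S"
      using hsubspaceD(1)[OF h J'(1)] by (intro sdim_mono gspan_subspace S)
    also have "\<dots> \<le> Suc (sdim k (gspan k J))"
      using hdim_adjoin_le[OF field_hom_id, of "gspan k J" k v] S C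
      by (simp add: hdim_id_eq_sdim subspaces_eq_hsubspaces[symmetric])
    ultimately show ?thesis using d by simp
  qed simp
qed

section \<open>Semilinear maps and column ranks\<close>

text \<open>Semilinearity along \<open>h\<close>: this covers the map from F_q-vectors to
  extension-field vectors given by a matrix and, with \<open>h\<close> the identity, ordinary linear
  maps over one field.\<close>

definition linmap ::
  "('q::{field,finite} \<Rightarrow> 'k::{field,finite}) \<Rightarrow> nat \<Rightarrow> nat \<Rightarrow> ('q vec \<Rightarrow> 'k vec) \<Rightarrow> bool" where
  "linmap h n k f \<longleftrightarrow> (\<forall>u\<in>carrier_vec n. f u \<in> carrier_vec k) \<and>
     (\<forall>u\<in>carrier_vec n. \<forall>v\<in>carrier_vec n. f (u + v) = f u + f v) \<and>
     (\<forall>c. \<forall>u\<in>carrier_vec n. f (c \<cdot>\<^sub>v u) = h c \<cdot>\<^sub>v f u)"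

lemma linmapD:
  assumes "linmap h n k f"
  shows "\<And>u. u \<in> carrier_vec n \<Longrightarrow> f u \<in> carrier_vec k"
    and "\<And>u v. u \<in> carrier_vec n \<Longrightarrow> v \<in> carrier_vec n \<Longrightarrow> f (u + v) = f u + f v"
    and "\<And>c u. u \<in> carrier_vec n \<Longrightarrow> f (c \<cdot>\<^sub>v u) = h c \<cdot>\<^sub>v f u"
  using assms unfolding linmap_def by blast+

lemma linmap_zero:
  assumes "field_hom h" "linmap h n k f"
  shows "f (0\<^sub>v n) = 0\<^sub>v k"
proof -
  interpret field_hom h by fact
  note f = linmapD[OF assms(2)]
  have "f (0 \<cdot>\<^sub>v 0\<^sub>v n) = h 0 \<cdot>\<^sub>v f (0\<^sub>v n)" by (rule f(3)) simp
  moreover have "0 \<cdot>\<^sub>v 0\<^sub>v n = (0\<^sub>v n :: 'a vec)" by (intro eq_vecI) auto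
  moreover have "0 \<cdot>\<^sub>v f (0\<^sub>v n) = 0\<^sub>v k" using f(1)[of "0\<^sub>v n"] by (intro eq_vecI) auto
  ultimately show ?thesis by simp
qed

lemma linmap_diff:
  assumes "field_hom h" "linmap h n k f" "u \<in> carrier_vec n" "v \<in> carrier_vec n"
  shows "f (u - v) = f u - f v"
proof -
  interpret field_hom h by fact
  note f = linmapD[OF assms(2)]
  have "u - v = u + (- 1) \<cdot>\<^sub>v v" using assms(3,4) by (intro eq_vecI) auto
  then have "f (u - v) = f u + h (- 1) \<cdot>\<^sub>v f v" using assms(3,4) f by simp
  also have "\<dots> = f u - f v"
    using f(1)[OF assms(3)] f(1)[OF assms(4)] by (intro eq_vecI) (auto simp: hom_uminus)
  finally show ?thesis .
qed

lemma linmap_image: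
  assumes "field_hom h" "linmap h n k f" "U \<in> subspaces n"
  shows "f ` U \<in> hsubspaces h k"
proof -
  note U = subspaceD[OF assms(3)]
  note f = linmapD[OF assms(2)]
  show ?thesis unfolding mem_hsubspaces[OF assms(1)]
  proof (intro conjI ballI allI)
    show "f ` U \<subseteq> carrier_vec k" using U(1) f(1) by blast
    show "0\<^sub>v k \<in> f ` U" using linmap_zero[OF assms(1,2)] U(2) by force
  next
    fix a b assume "a \<in> f ` U" "b \<in> f ` U"
    then obtain u v where uv: "u \<in> U" "v \<in> U" "a = f u" "b = f v" by blast
    then have "a + b = f (u + v)" using f(2) U(1) by (simp add: subset_iff)
    then show "a + b \<in> f ` U" using U(3) uv by blast
  next
    fix c a assume "a \<in> f ` U"
    then obtain u where u: "u \<in> U" "a = f u" by blast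
    then have "h c \<cdot>\<^sub>v a = f (c \<cdot>\<^sub>v u)" using f(3) U(1) by (simp add: subset_iff)
    then show "h c \<cdot>\<^sub>v a \<in> f ` U" using U(4) u by blast
  qed
qed

lemma linmap_vimage:
  assumes "field_hom h" "linmap h n k f" "W \<in> hsubspaces h k" "U \<in> subspaces n"
  shows "{u \<in> U. f u \<in> W} \<in> subspaces n"
proof -
  note U = subspaceD[OF assms(4)]
  have "u \<in> carrier_vec n" if "u \<in> U" for u using that U(1) by blast
  then show ?thesis
    unfolding mem_subspaces
    using U linmapD[OF assms(2)] linmap_zero[OF assms(1,2)] hsubspaceD[OF assms(1,3)] by auto
qed

lemma linmap_image_subspace:
  "linmap (\<lambda>x. x) n k f \<Longrightarrow> U \<in> subspaces n \<Longrightarrow> f ` U \<in> subspaces k"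
  using linmap_image[OF field_hom_id] by (simp add: subspaces_eq_hsubspaces)

lemma carrier_subspace: "carrier_vec n \<in> subspaces n"
  by (simp add: mem_subspaces)

lemma zero_subspace: "{0\<^sub>v n} \<in> subspaces n"
  by (auto simp: mem_subspaces)

lemma linmap_inj_on:
  assumes "field_hom h" "linmap h n k f" "U \<in> subspaces n"
    and "\<And>u. u \<in> U \<Longrightarrow> f u = 0\<^sub>v k \<Longrightarrow> u = 0\<^sub>v n"
  shows "inj_on f U"
proof (rule inj_onI)
  fix u v assume uv: "u \<in> U" "v \<in> U" "f u = f v"
  have C: "u \<in> carrier_vec n" "v \<in> carrier_vec n" using uv subspaceD(1)[OF assms(3)] by auto
  have "f (u - v) = 0\<^sub>v k"
    using linmap_diff[OF assms(1,2) C] linmapD(1)[OF assms(2) C(2)] uv(3) by simp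
  moreover have "u - v \<in> U"
    using hsubspaceD(5)[OF field_hom_id] assms(3) uv by (simp add: subspaces_eq_hsubspaces)
  ultimately have "u - v = 0\<^sub>v n" using assms(4) by blast
  moreover have "u = (u - v) + v" using C by (intro eq_vecI) auto
  ultimately show "u = v" using C by simp
qed

text \<open>Rank-nullity in multiplicative form: after choosing one preimage \<open>s w\<close> for
  every value \<open>w\<close>, each element of \<open>U\<close> is uniquely a kernel element plus
  some \<open>s w\<close>.\<close>

lemma card_linmap:
  assumes h: "field_hom h" and f: "linmap h n k f" and U: "U \<in> subspaces n"
  shows "card U = card {u \<in> U. f u = 0\<^sub>v k} * card (f ` U)"
proof -
  let ?K = "{u \<in> U. f u = 0\<^sub>v k}"
  define s where "s w = (SOME u. u \<in> U \<and> f u = w)" for w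
  have s: "s w \<in> U" "f (s w) = w" if "w \<in> f ` U" for w
    using someI_ex[of "\<lambda>u. u \<in> U \<and> f u = w"] that unfolding s_def by blast+
  note UD = subspaceD[OF U]
  have C: "u \<in> carrier_vec n" if "u \<in> U" for u using that UD(1) by blast
  have diff: "u - v \<in> U" if "u \<in> U" "v \<in> U" for u v
    using hsubspaceD(5)[OF field_hom_id] U that by (simp add: subspaces_eq_hsubspaces)
  have fC: "f u \<in> carrier_vec k" if "u \<in> U" for u using linmapD(1)[OF f C[OF that]] .
  have "bij_betw (\<lambda>(u, w). u + s w) (?K \<times> f ` U) U"
  proof (rule bij_betw_byWitness[where f' = "\<lambda>u. (u - s (f u), f u)"])
    have fs: "f (u + s w) = w" if "u \<in> ?K" "w \<in> f ` U" for u w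
      using that s[OF that(2)] linmapD(2)[OF f, of u "s w"] C fC by auto
    show "\<forall>x\<in>?K \<times> f ` U. (\<lambda>u. (u - s (f u), f u)) (case x of (u, w) \<Rightarrow> u + s w) = x"
    proof
      fix x assume "x \<in> ?K \<times> f ` U"
      then obtain u w where x: "x = (u, w)" "u \<in> ?K" "w \<in> f ` U" by (elim SigmaE)
      have "u \<in> carrier_vec n" "s w \<in> carrier_vec n" using x C s(1) by auto
      then have "u + s w - s w = u" by (intro eq_vecI) auto
      then show "(\<lambda>u. (u - s (f u), f u)) (case x of (u, w) \<Rightarrow> u + s w) = x"
        using fs[OF x(2,3)] x(1) by simp
    qed
    show "\<forall>u\<in>U. (case (u - s (f u), f u) of (u, w) \<Rightarrow> u + s w) = u"
    proof (rule ballI, simp)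
      fix u assume "u \<in> U"
      then show "u - s (f u) + s (f u) = u"
        using C[of u] C[OF s(1)[of "f u"]] by (intro eq_vecI) auto
    qed
    show "(\<lambda>(u, w). u + s w) ` (?K \<times> f ` U) \<subseteq> U" using s UD(3) by auto
    show "(\<lambda>u. (u - s (f u), f u)) ` U \<subseteq> ?K \<times> f ` U"
    proof clarsimp
      fix u assume u: "u \<in> U"
      then have su: "s (f u) \<in> U" "f (s (f u)) = f u" using s by blast+
      then show "u - s (f u) \<in> U \<and> f (u - s (f u)) = 0\<^sub>v k"
        using linmap_diff[OF h f C[OF u] C[OF su(1)]] fC[OF u] diff[OF u su(1)] by simp
    qed
  qed
  from bij_betw_same_card[OF this] show ?thesis by (simp add: card_cartesian_product)
qed

lemma hdim_linmap_inj:
  fixes h :: "'q::{field,finite} \<Rightarrow> 'k::{field,finite}"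
  assumes "field_hom h" "linmap h n k f" "U \<in> subspaces n" "inj_on f U"
  shows "hdim h k (f ` U) = sdim n U"
proof -
  have "CARD('q) ^ hdim h k (f ` U) = CARD('q) ^ sdim n U"
    using card_hsubspace[OF assms(1) linmap_image[OF assms(1-3)]] card_subspace[OF assms(3)]
      card_image[OF assms(4)] by simp
  then show ?thesis using power_inject_exp[OF field_card_gt_1] by blast
qed

lemma sdim_linmap_inj:
  assumes "linmap (\<lambda>x. x) n k f" "U \<in> subspaces n" "inj_on f U"
  shows "sdim k (f ` U) = sdim n U"
  using hdim_linmap_inj[OF field_hom_id assms] linmap_image_subspace[OF assms(1,2)]
  by (simp add: hdim_id_eq_sdim)

lemma hdim_linmap_le:
  fixes h :: "'q::{field,finite} \<Rightarrow> 'k::{field,finite}"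
  assumes "field_hom h" "linmap h n k f" "U \<in> subspaces n"
  shows "hdim h k (f ` U) \<le> sdim n U"
proof -
  have "finite U" using assms(3) finite_hsubspace[OF field_hom_id] by (simp add: subspaces_eq_hsubspaces)
  then have "CARD('q) ^ hdim h k (f ` U) \<le> CARD('q) ^ sdim n U"
    using card_hsubspace[OF assms(1) linmap_image[OF assms]] card_subspace[OF assms(3)]
      card_image_le[of U f] by simp
  then show ?thesis using power_le_imp_le_exp[OF field_card_gt_1] by blast
qed

text \<open>The preimage of a space over the large field is a subspace over the small one, so it
  contains the span of \<open>S\<close> once it contains \<open>S\<close>. Hence the span of the
  image depends on \<open>S\<close> only through the subspace that \<open>S\<close>
  generates.\<close>

lemma gspan_image_gspan:
  assumes h: "field_hom h" and f: "linmap h n k f" and S: "S \<subseteq> carrier_vec n"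
  shows "gspan k (f ` gspan n S) = gspan k (f ` S)"
proof
  have fS: "f ` S \<subseteq> carrier_vec k" using linmapD(1)[OF f] S by blast
  have "{u \<in> carrier_vec n. f u \<in> gspan k (f ` S)} \<in> subspaces n"
    by (intro linmap_vimage[OF h f] subspace_hsubspace h gspan_subspace fS carrier_subspace)
  then have "gspan n S \<subseteq> {u \<in> carrier_vec n. f u \<in> gspan k (f ` S)}"
    using S subset_gspan[OF fS] by (intro gspan_least) auto
  then show "gspan k (f ` gspan n S) \<subseteq> gspan k (f ` S)"
    by (intro gspan_least gspan_subspace fS) auto
  have "f ` gspan n S \<subseteq> carrier_vec k"
    using linmapD(1)[OF f] subspaceD(1)[OF gspan_subspace[OF S]] by blast
  then show "gspan k (f ` S) \<subseteq> gspan k (f ` gspan n S)"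
    using subset_gspan[OF S] by (intro gspan_mono image_mono)
qed

lemma gspan_idem: "U \<in> subspaces n \<Longrightarrow> gspan n U = U"
  by (intro subset_antisym gspan_least order_refl subset_gspan subspaceD(1))

lemma gspan_linmap:
  assumes f: "linmap (\<lambda>x. x) n k f" and S: "S \<subseteq> carrier_vec n"
  shows "gspan k (f ` S) = f ` gspan n S"
  using gspan_image_gspan[OF field_hom_id assms]
    gspan_idem[OF linmap_image_subspace[OF f gspan_subspace[OF S]]] by simp

section \<open>The column map of a matrix and its rank function\<close>

definition colmap :: "('q::{field,finite} \<Rightarrow> 'k::{field,finite}) \<Rightarrow> 'k mat \<Rightarrow> 'q vec \<Rightarrow> 'k vec" where
  "colmap h G u = G *\<^sub>v map_vec h u"

lemma linmap_colmap:
  assumes "field_hom h" "G \<in> carrier_mat k n"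
  shows "linmap h n k (colmap h G)"
proof -
  interpret field_hom h by fact
  have 1: "map_vec h (u + v) = map_vec h u + map_vec h v"
    if "u \<in> carrier_vec n" "v \<in> carrier_vec n" for u v
    using that by (intro eq_vecI) (auto simp: hom_add)
  show ?thesis unfolding linmap_def colmap_def
    using assms(2) by (auto simp: 1 vec_hom_smult mult_add_distrib_mat_vec mult_mat_vec)
qed

text \<open>This gives meaning to the choice \<open>SOME A\<close> in
  \<open>matrix_qmatroid\<close>: the columns of a witness list a finite basis of
  \<open>U\<close>.\<close>

lemma exists_basis_matrix:
  fixes U :: "'q::{field,finite} vec set"
  assumes "U \<in> subspaces n"
  shows "\<exists>A. basis_matrix n U A"
proof -
  interpret V: vectorspace class_ring "module_vec TYPE('q) n" by (rule vec_vs)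
  interpret U: vectorspace class_ring "module_vec TYPE('q) n \<lparr>carrier := U\<rparr>"
    using V.subspace_is_vs assms by (simp add: subspaces_def)
  have fin: "finite U" using assms finite_hsubspace[OF field_hom_id] by (simp add: subspaces_eq_hsubspaces)
  have "U.gen_set U"
    using U.in_own_span[of U] U.span_is_subset2[of U] by auto
  then have "U.fin_dim" unfolding U.fin_dim_def using fin by (intro exI[of _ U]) auto
  then obtain B where B: "finite B" "U.basis B" using U.finite_basis_exists by blast
  obtain bs where bs: "set bs = B" "distinct bs" using finite_distinct_list[OF B(1)] by blast
  have "B \<subseteq> carrier_vec n" using B(2) subspaceD(1)[OF assms] by (auto simp: U.basis_def)
  then have "cols (mat_of_cols n bs) = bs" using bs by (intro cols_mat_of_cols) auto
  then show ?thesis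
    unfolding basis_matrix_def using B bs by (intro exI[of _ "mat_of_cols n bs"]) simp
qed

lemma basis_matrix_gspan:
  fixes U :: "'q::{field,finite} vec set"
  assumes "U \<in> subspaces n" "basis_matrix n U A"
  shows "set (cols A) \<subseteq> U" and "gspan n (set (cols A)) = U"
proof -
  interpret V: vectorspace class_ring "module_vec TYPE('q) n" by (rule vec_vs)
  interpret U: vectorspace class_ring "module_vec TYPE('q) n \<lparr>carrier := U\<rparr>"
    using V.subspace_is_vs assms by (simp add: subspaces_def)
  have B: "U.basis (set (cols A))" using assms(2) by (simp add: basis_matrix_def)
  then show sub: "set (cols A) \<subseteq> U" by (auto simp: U.basis_def)
  have "submodule class_ring U (module_vec TYPE('q) n)"
    using assms(1) by (simp add: subspaces_def subspace_def)
  from V.span_li_not_depend(1)[OF sub this] B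
  show "gspan n (set (cols A)) = U" by (simp add: U.basis_def)
qed

text \<open>A basis-free form of the rank function of \<open>M[G]\<close>: the whole image of
  \<open>U\<close> is spanned, in place of the images of chosen basis vectors.\<close>

definition colrank :: "('q::{field,finite} \<Rightarrow> 'k::{field,finite}) \<Rightarrow> 'k mat \<Rightarrow> 'q vec set \<Rightarrow> nat" where
  "colrank h G U = sdim (dim_row G) (gspan (dim_row G) (colmap h G ` U))"

lemma rank_eq_sdim_gspan: "vec_space.rank k G = sdim k (gspan k (set (cols G)))"
  by (simp add: vec_space.rank_def sdim_def)

lemma cols_mult_map_mat:
  assumes "G \<in> carrier_mat k n" "dim_row A = n"
  shows "set (cols (G * map_mat h A)) = colmap h G ` set (cols A)"
proof -
  have "col (G * map_mat h A) j = colmap h G (col A j)" if "j < dim_col A" for j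
  proof -
    have "map_mat h A \<in> carrier_mat n (dim_col A)" using assms(2) by (intro carrier_matI) simp_all
    from col_mult2[OF assms(1) this that] show ?thesis using that by (simp add: colmap_def)
  qed
  then show ?thesis using assms by (simp add: cols_def image_image image_set)
qed

text \<open>The columns of \<open>G * map_mat h A\<close> are the images of a basis of
  \<open>U\<close>, and by \<open>gspan_image_gspan\<close> they span the same space as the image of
  all of \<open>U\<close>.\<close>

lemma matrix_qmatroid_eq_colrank:
  fixes h :: "'q::{field,finite} \<Rightarrow> 'k::{field,finite}"
  assumes h: "field_hom h" and U: "U \<in> subspaces (dim_col G)"
  shows "matrix_qmatroid h G U = int (colrank h G U)"
proof -
  define A where "A = (SOME A. basis_matrix (dim_col G) U A)"
  have A: "basis_matrix (dim_col G) U A"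
    unfolding A_def using exists_basis_matrix[OF U] by (rule someI_ex)
  have G: "G \<in> carrier_mat (dim_row G) (dim_col G)" by simp
  have "dim_row A = dim_col G" using A by (simp add: basis_matrix_def)
  then have "set (cols (G * map_mat h A)) = colmap h G ` set (cols A)"
    by (intro cols_mult_map_mat[OF G])
  moreover have "gspan (dim_row G) (colmap h G ` set (cols A)) = gspan (dim_row G) (colmap h G ` U)"
    using gspan_image_gspan[OF h linmap_colmap[OF h G], of "set (cols A)"]
      basis_matrix_gspan[OF U A] subspaceD(1)[OF U] by auto
  ultimately show ?thesis
    by (simp add: matrix_qmatroid_def colrank_def rank_eq_sdim_gspan flip: A_def)
qed

section \<open>Free products\<close>

lemma inter_subspace: "A \<in> subspaces n \<Longrightarrow> B \<in> subspaces n \<Longrightarrow> A \<inter> B \<in> subspaces n"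
  unfolding mem_subspaces by blast

lemma ssum_subspace:
  fixes A B :: "'a::{field,finite} vec set"
  assumes "A \<in> subspaces n" "B \<in> subspaces n"
  shows "ssum n A B \<in> subspaces n" and "A \<subseteq> ssum n A B" and "B \<subseteq> ssum n A B"
    and "W \<in> subspaces n \<Longrightarrow> A \<subseteq> W \<Longrightarrow> B \<subseteq> W \<Longrightarrow> ssum n A B \<subseteq> W"
proof -
  interpret vectorspace class_ring "module_vec TYPE('a) n" by (rule vec_vs)
  note AB = assms[unfolded subspaces_def mem_Collect_eq]
  show "ssum n A B \<in> subspaces n" using sum_is_subspace[OF AB] by (simp add: ssum_def subspaces_def)
  show "A \<subseteq> ssum n A B" using in_sum_vs[OF AB] by (simp add: ssum_def)
  show "B \<subseteq> ssum n A B" using in_sum_vs[OF AB(2,1)] vsum_comm[OF AB] by (simp add: ssum_def)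
  show "W \<in> subspaces n \<Longrightarrow> A \<subseteq> W \<Longrightarrow> B \<subseteq> W \<Longrightarrow> ssum n A B \<subseteq> W"
    using vsum_is_minimal[OF AB, of W] by (simp add: ssum_def subspaces_def)
qed

lemma sdim_zero: "sdim n {0\<^sub>v n :: 'a::{field,finite} vec} = 0"
proof -
  have "CARD('a) ^ sdim n {0\<^sub>v n :: 'a vec} = CARD('a) ^ 0"
    using card_subspace[OF zero_subspace, of n, where 'a='a] by simp
  then show ?thesis using power_inject_exp[OF field_card_gt_1] by blast
qed

lemma sdim_carrier: "sdim n (carrier_vec n :: 'a::{field,finite} vec set) = n"
proof -
  have "CARD('a) ^ sdim n (carrier_vec n :: 'a vec set) = CARD('a) ^ n"
    using card_subspace[OF carrier_subspace, of n, where 'a='a] by (simp add: card_carrier_vec)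
  then show ?thesis using power_inject_exp[OF field_card_gt_1] by blast
qed

lemma qmatroidD:
  assumes "qmatroid n r"
  shows "\<And>A. A \<in> subspaces n \<Longrightarrow> 0 \<le> r A"
    and "\<And>A. A \<in> subspaces n \<Longrightarrow> r A \<le> int (sdim n A)"
    and "\<And>A B. A \<in> subspaces n \<Longrightarrow> B \<in> subspaces n \<Longrightarrow> A \<subseteq> B \<Longrightarrow> r A \<le> r B"
    and "\<And>A B. A \<in> subspaces n \<Longrightarrow> B \<in> subspaces n \<Longrightarrow> r (ssum n A B) + r (A \<inter> B) \<le> r A + r B"
  using assms unfolding qmatroid_def by blast+

text \<open>All dimensions stay below \<open>Suc n\<close>, so a largest one is attained.\<close>

lemma subspace_max:
  fixes A :: "'a::{field,finite} vec set"
  assumes "P I0" and P: "\<And>I. P I \<Longrightarrow> I \<in> subspaces n"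
  shows "\<exists>I. P I \<and> (\<forall>W. P W \<longrightarrow> sdim n W \<le> sdim n (I :: 'a vec set))"
proof -
  have "sdim n W < Suc n" if "P W" for W
    using sdim_mono[OF P[OF that] carrier_subspace subspaceD(1)[OF P[OF that]]]
    by (simp add: sdim_carrier)
  then show ?thesis using ex_has_greatest_nat[of P I0 "sdim n" "Suc n"] assms(1) by blast
qed

text \<open>A largest independent \<open>I\<close> inside \<open>A\<close> works. Adding any one
  vector of \<open>A\<close> does not raise the rank, and submodularity allows such extensions to be
  summed without raising it either, until they exhaust \<open>A\<close>.\<close>

lemma qmatroid_exists_basis:
  assumes M: "qmatroid n r" and A: "A \<in> subspaces n"
  obtains I where "qindep n r I" and "I \<subseteq> A" and "r I = r A"
proof -
  note r = qmatroidD[OF M]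
  define P where "P I \<longleftrightarrow> qindep n r I \<and> I \<subseteq> A" for I
  have "qindep n r {0\<^sub>v n}" using r(1)[OF zero_subspace] r(2)[OF zero_subspace]
    by (simp add: qindep_def zero_subspace sdim_zero)
  moreover have "{0\<^sub>v n} \<subseteq> A" using subspaceD(2)[OF A] by simp
  ultimately have "P {0\<^sub>v n}" by (simp add: P_def)
  moreover have "I \<in> subspaces n" if "P I" for I
    using that by (simp add: P_def qindep_def)
  ultimately obtain I where PI: "P I" and Imax: "\<And>W. P W \<Longrightarrow> sdim n W \<le> sdim n I"
    using subspace_max[of P] by blast
  then have I: "qindep n r I" "I \<subseteq> A" by (simp_all add: P_def)
  have Is: "I \<in> subspaces n" "r I = int (sdim n I)" using I(1) by (auto simp: qindep_def)
  have step: "\<exists>B. B \<in> subspaces n \<and> I \<subseteq> B \<and> v \<in> B \<and> B \<subseteq> A \<and> r B = r I"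
    if v: "v \<in> A" for v
  proof (cases "v \<in> I")
    case True
    then show ?thesis using I Is by blast
  next
    case False
    let ?B = "adjoin (\<lambda>x. x) I v"
    have vC: "v \<in> carrier_vec n" using v subspaceD(1)[OF A] by blast
    have B: "?B \<in> subspaces n" "I \<subseteq> ?B" "v \<in> ?B" "?B \<subseteq> A" "sdim n ?B = Suc (sdim n I)"
      using adjoin_hsubspace[OF field_hom_id _ vC, of I] hdim_adjoin[OF field_hom_id _ vC False]
        adjoin_least[OF field_hom_id, of A n I v] Is(1) A I(2) v
      by (simp_all add: subspaces_eq_hsubspaces[symmetric] hdim_id_eq_sdim)
    \<comment> \<open>By maximality of \<open>I\<close> the larger space is dependent; since its
      dimension is only one more, its rank cannot exceed that of \<open>I\<close>.\<close>
    have "r ?B \<noteq> int (sdim n ?B)" using Imax[of ?B] B by (auto simp: P_def qindep_def)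
    then have "r ?B = r I" using r(2)[OF B(1)] r(3)[OF Is(1) B(1,2)] Is(2) B(5) by simp
    then show ?thesis using B by blast
  qed
  \<comment> \<open>A largest space between \<open>I\<close> and \<open>A\<close> that still has the
    rank of \<open>I\<close>; the aim is that it equals \<open>A\<close>.\<close>
  define Q where "Q W \<longleftrightarrow> W \<in> subspaces n \<and> I \<subseteq> W \<and> W \<subseteq> A \<and> r W = r I" for W
  have "Q I" using I(2) Is(1) by (simp add: Q_def)
  moreover have "W \<in> subspaces n" if "Q W" for W using that by (simp add: Q_def)
  ultimately obtain W where QW: "Q W" and Wmax: "\<And>W'. Q W' \<Longrightarrow> sdim n W' \<le> sdim n W"
    using subspace_max[of Q] by blast
  have W: "W \<in> subspaces n" "I \<subseteq> W" "W \<subseteq> A" "r W = r I"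
    using QW by (simp_all add: Q_def)
  have "W = A"
  proof (rule ccontr)
    assume "W \<noteq> A"
    then obtain v where v: "v \<in> A" "v \<notin> W" using W(3) by blast
    then obtain B where B: "B \<in> subspaces n" "I \<subseteq> B" "v \<in> B" "B \<subseteq> A" "r B = r I"
      using step by blast
    note S = ssum_subspace[OF W(1) B(1)]
    \<comment> \<open>The intersection contains \<open>I\<close>, so submodularity leaves at most
      \<open>r I\<close> for the rank of the sum. The sum then competes with \<open>W\<close> and
      contains \<open>v\<close>.\<close>
    have "r I \<le> r (W \<inter> B)" using W B Is by (intro r(3) inter_subspace) auto
    then have "r (ssum n W B) \<le> r I" using r(4)[OF W(1) B(1)] W(4) B(5) by simp
    moreover have "r I \<le> r (ssum n W B)" using W(2) S by (intro r(3) Is) auto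
    ultimately have "sdim n (ssum n W B) \<le> sdim n W"
      using W B S(1,2) S(4)[OF A] by (intro Wmax) (auto simp: Q_def)
    then have "W = ssum n W B" using S W(1) by (intro subspace_eqI)
    then show False using v(2) B(3) S(3) by blast
  qed
  then show thesis using that I W(4) by simp
qed

section \<open>Coordinates on the direct sum\<close>

lemma linmap_emb1: "linmap (\<lambda>x. x) n1 (n1 + n2) (emb1 n2)"
  by (auto simp: linmap_def emb1_def intro!: eq_vecI)

lemma linmap_vec_last: "linmap (\<lambda>x. x) (n1 + n2) n2 (\<lambda>v. vec_last v n2)"
  by (auto simp: linmap_def vec_last_def intro!: eq_vecI)

lemma linmap_vec_first: "linmap (\<lambda>x. x) (n1 + n2) n1 (\<lambda>v. vec_first v n1)"
  by (auto simp: linmap_def vec_first_def intro!: eq_vecI)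

lemma vec_first_append: "u \<in> carrier_vec n1 \<Longrightarrow> vec_first (u @\<^sub>v w) n1 = u"
  by (auto simp: vec_first_def intro!: eq_vecI)

lemma vec_last_append: "u \<in> carrier_vec n1 \<Longrightarrow> w \<in> carrier_vec n2 \<Longrightarrow> vec_last (u @\<^sub>v w) n2 = w"
  by (auto simp: vec_last_def intro!: eq_vecI)

lemma vec_first_emb1: "u \<in> carrier_vec n1 \<Longrightarrow> vec_first (emb1 n2 u) n1 = u"
  by (simp add: emb1_def vec_first_append)

lemma vec_last_emb1: "u \<in> carrier_vec n1 \<Longrightarrow> vec_last (emb1 n2 u) n2 = 0\<^sub>v n2"
  by (simp add: emb1_def vec_last_append)

lemma inj_on_emb1: "A \<subseteq> carrier_vec n1 \<Longrightarrow> inj_on (emb1 n2) A"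
  by (rule inj_on_inverseI[of _ "\<lambda>v. vec_first v n1"]) (auto simp: vec_first_emb1)

lemma emb1_vec_first:
  "v \<in> carrier_vec (n1 + n2) \<Longrightarrow> vec_last v n2 = 0\<^sub>v n2 \<Longrightarrow> emb1 n2 (vec_first v n1) = v"
  using vec_first_last_append[of v n1 n2] by (simp add: emb1_def)

text \<open>The space \<open>\<pi>\<^sub>1 (I \<inter> \<iota>\<^sub>1 E\<^sub>1)\<close> of the
  free product, written as a preimage under the embedding so that it is visibly a subspace.\<close>

definition fiber1 :: "nat \<Rightarrow> nat \<Rightarrow> 'a::{field,finite} vec set \<Rightarrow> 'a vec set" where
  "fiber1 n1 n2 I = {u \<in> carrier_vec n1. emb1 n2 u \<in> I}"

lemma fiber1_subspace:
  assumes "I \<in> subspaces (n1 + n2)"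
  shows "fiber1 n1 n2 I \<in> subspaces n1"
  using linmap_vimage[OF field_hom_id linmap_emb1[of n1 n2] _ carrier_subspace, of I] assms
  by (simp add: fiber1_def subspaces_eq_hsubspaces)

lemma emb1_fiber1:
  assumes "I \<in> subspaces (n1 + n2)"
  shows "emb1 n2 ` fiber1 n1 n2 I = {v \<in> I. vec_last v n2 = 0\<^sub>v n2}"
proof (intro subset_antisym subsetI)
  fix v assume "v \<in> {v \<in> I. vec_last v n2 = 0\<^sub>v n2}"
  then have "v \<in> I" "emb1 n2 (vec_first v n1) = v"
    using subspaceD(1)[OF assms] emb1_vec_first[of v n1 n2] by auto
  then show "v \<in> emb1 n2 ` fiber1 n1 n2 I"
    unfolding fiber1_def by (intro image_eqI[of _ _ "vec_first v n1"]) auto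
qed (auto simp: fiber1_def vec_last_emb1)

lemma vec_first_image_eq_fiber1:
  "(\<lambda>v. vec_first v n1) ` (I \<inter> emb1 n2 ` carrier_vec n1) = fiber1 n1 n2 I"
  by (force simp: fiber1_def vec_first_emb1 image_iff)

lemma free_product_indep_iff:
  "free_product_indep n1 n2 r1 r2 I \<longleftrightarrow> qindep n1 r1 (fiber1 n1 n2 I) \<and>
     r1 (carrier_vec n1) - r1 (fiber1 n1 n2 I) \<ge>
     int (sdim n2 ((\<lambda>v. vec_last v n2) ` I)) - r2 ((\<lambda>v. vec_last v n2) ` I)"
  unfolding free_product_indep_def Let_def colevel_def nullity_def vec_first_image_eq_fiber1 ..

lemma sdim_emb1: "A \<in> subspaces n1 \<Longrightarrow> sdim (n1 + n2) (emb1 n2 ` A) = sdim n1 A"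
  by (intro sdim_linmap_inj[OF linmap_emb1] inj_on_emb1 subspaceD(1))

text \<open>Rank-nullity for the projection to the last \<open>n2\<close> coordinates: its kernel on
  \<open>I\<close> is the embedded fibre.\<close>

lemma sdim_split:
  fixes I :: "'a::{field,finite} vec set"
  assumes "I \<in> subspaces (n1 + n2)"
  shows "sdim (n1 + n2) I = sdim n1 (fiber1 n1 n2 I) + sdim n2 ((\<lambda>v. vec_last v n2) ` I)"
proof -
  have "card (emb1 n2 ` fiber1 n1 n2 I) = card (fiber1 n1 n2 I)"
    by (intro card_image inj_on_emb1) (auto simp: fiber1_def)
  then have "CARD('a) ^ sdim (n1 + n2) I =
      CARD('a) ^ (sdim n1 (fiber1 n1 n2 I) + sdim n2 ((\<lambda>v. vec_last v n2) ` I))"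
    using card_linmap[OF field_hom_id linmap_vec_last assms] card_subspace[OF assms]
      card_subspace[OF fiber1_subspace[OF assms]]
      card_subspace[OF linmap_image_subspace[OF linmap_vec_last assms]]
    by (simp add: power_add emb1_fiber1[OF assms])
  then show ?thesis using power_inject_exp[OF field_card_gt_1] by blast
qed

text \<open>This is the direct sum of \<open>E\<^sub>1\<close> and \<open>B\<close>. Its rank minus
  the rank of \<open>E\<^sub>1\<close> is the rank of \<open>B\<close> in the contraction by
  \<open>E\<^sub>1\<close>.\<close>

definition cylinder :: "nat \<Rightarrow> nat \<Rightarrow> 'a::{field,finite} vec set \<Rightarrow> 'a vec set" where
  "cylinder n1 n2 B = {v \<in> carrier_vec (n1 + n2). vec_last v n2 \<in> B}"

lemma cylinder_subspace:
  assumes "B \<in> subspaces n2"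
  shows "cylinder n1 n2 B \<in> subspaces (n1 + n2)"
  using linmap_vimage[OF field_hom_id linmap_vec_last[of n1 n2] _ carrier_subspace, of B] assms
  by (simp add: cylinder_def subspaces_eq_hsubspaces)

lemma fiber1_emb1: "A \<subseteq> carrier_vec n1 \<Longrightarrow> fiber1 n1 n2 (emb1 n2 ` A) = A"
  unfolding fiber1_def by (auto dest: inj_onD[OF inj_on_emb1[OF order_refl]])

lemma vec_last_image_emb1:
  assumes "A \<in> subspaces n1"
  shows "(\<lambda>v. vec_last v n2) ` emb1 n2 ` A = {0\<^sub>v n2}"
proof -
  have "(\<lambda>v. vec_last v n2) ` emb1 n2 ` A = (\<lambda>_. 0\<^sub>v n2) ` A"
    unfolding image_image
  proof (rule image_cong[OF refl])
    show "vec_last (emb1 n2 u) n2 = 0\<^sub>v n2" if "u \<in> A" for u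
      using that subspaceD(1)[OF assms] by (intro vec_last_emb1) blast
  qed
  then show ?thesis using subspaceD(2)[OF assms] by auto
qed

section \<open>Restriction and contraction of the free product\<close>

locale free_product =
  fixes n1 n2 :: nat and r1 r2 r :: "'q::{field,finite} vec set \<Rightarrow> int"
  assumes M1: "qmatroid n1 r1" and M2: "qmatroid n2 r2" and fp: "is_free_product n1 n2 r1 r2 r"
begin

lemma M: "qmatroid (n1 + n2) r"
  using fp by (simp add: is_free_product_def)

lemma qindep_iff:
  "I \<in> subspaces (n1 + n2) \<Longrightarrow> qindep (n1 + n2) r I \<longleftrightarrow> free_product_indep n1 n2 r1 r2 I"
  using fp by (simp add: is_free_product_def)

text \<open>An embedded subspace of \<open>E\<^sub>1\<close> projects to zero in
  \<open>E\<^sub>2\<close>, where the nullity is zero. The defining inequality then reduces to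
  monotonicity of \<open>r1\<close>.\<close>

lemma qindep_emb1:
  assumes "A \<in> subspaces n1"
  shows "qindep (n1 + n2) r (emb1 n2 ` A) \<longleftrightarrow> qindep n1 r1 A"
proof -
  have "r2 {0\<^sub>v n2} = 0"
    using qmatroidD(1,2)[OF M2 zero_subspace] by (simp add: sdim_zero)
  moreover have "r1 A \<le> r1 (carrier_vec n1)"
    by (intro qmatroidD(3)[OF M1] assms carrier_subspace subspaceD(1))
  ultimately show ?thesis
    using qindep_iff[OF linmap_image_subspace[OF linmap_emb1 assms]]
      fiber1_emb1[OF subspaceD(1)[OF assms]] vec_last_image_emb1[OF assms]
    by (simp add: free_product_indep_iff sdim_zero)
qed

text \<open>The restriction to \<open>E\<^sub>1\<close> is the first factor: both ranks are attained
  on independent subspaces, and \<open>qindep_emb1\<close> matches these.\<close>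

lemma rank_emb1:
  assumes A: "A \<in> subspaces n1"
  shows "r (emb1 n2 ` A) = r1 A"
proof (rule antisym)
  note eA = linmap_image_subspace[OF linmap_emb1 A, of n2]
  obtain I where I: "qindep (n1 + n2) r I" "I \<subseteq> emb1 n2 ` A" "r I = r (emb1 n2 ` A)"
    using qmatroid_exists_basis[OF M eA] .
  then have Is: "I \<in> subspaces (n1 + n2)" by (simp add: qindep_def)
  \<comment> \<open>Since \<open>I\<close> lies in the embedded copy of \<open>E\<^sub>1\<close>, it
    is recovered from its fibre.\<close>
  have eI: "emb1 n2 ` fiber1 n1 n2 I = I"
  proof -
    have "vec_last v n2 = 0\<^sub>v n2" if v: "v \<in> I" for v
    proof -
      from v I(2) obtain u where "u \<in> A" "v = emb1 n2 u" by blast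
      then show ?thesis using subspaceD(1)[OF A] by (auto simp: vec_last_emb1)
    qed
    then show ?thesis unfolding emb1_fiber1[OF Is] by blast
  qed
  have F: "fiber1 n1 n2 I \<in> subspaces n1" by (rule fiber1_subspace[OF Is])
  have "qindep n1 r1 (fiber1 n1 n2 I)" using I(1) qindep_emb1[OF F] eI by simp
  then have "r1 (fiber1 n1 n2 I) = r I"
    using I(1) sdim_emb1[OF F, of n2] eI by (simp add: qindep_def)
  moreover have "fiber1 n1 n2 I \<subseteq> A"
    using I(2) fiber1_emb1[OF subspaceD(1)[OF A]] by (auto simp: fiber1_def)
  ultimately show "r (emb1 n2 ` A) \<le> r1 A" using qmatroidD(3)[OF M1 F A] I(3) by simp
next
  obtain I where I: "qindep n1 r1 I" "I \<subseteq> A" "r1 I = r1 A"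
    using qmatroid_exists_basis[OF M1 A] .
  then have Is: "I \<in> subspaces n1" by (simp add: qindep_def)
  have "r (emb1 n2 ` I) = r1 I"
    using I(1) qindep_emb1[OF Is] sdim_emb1[OF Is, of n2] by (simp add: qindep_def)
  then show "r1 A \<le> r (emb1 n2 ` A)"
    using qmatroidD(3)[OF M linmap_image_subspace[OF linmap_emb1 Is] linmap_image_subspace[OF linmap_emb1 A]]
      I(2,3) by (simp add: image_mono)
qed

text \<open>The contraction by \<open>E\<^sub>1\<close> is the second factor. A basis of the
  cylinder obeys the defining inequality, which bounds its dimension from above; the direct sum of a
  basis of the first factor and a basis of \<open>B\<close> attains the bound.\<close>

lemma rank_cylinder:
  assumes B: "B \<in> subspaces n2"
  shows "r (cylinder n1 n2 B) = r1 (carrier_vec n1) + r2 B"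
proof (rule antisym)
  note cB = cylinder_subspace[OF B, of n1]
  obtain I where I: "qindep (n1 + n2) r I" "I \<subseteq> cylinder n1 n2 B" "r I = r (cylinder n1 n2 B)"
    using qmatroid_exists_basis[OF M cB] .
  then have Is: "I \<in> subspaces (n1 + n2)" by (simp add: qindep_def)
  let ?I1 = "fiber1 n1 n2 I" and ?I2 = "(\<lambda>v. vec_last v n2) ` I"
  have "qindep n1 r1 ?I1" "r1 (carrier_vec n1) - r1 ?I1 \<ge> int (sdim n2 ?I2) - r2 ?I2"
    using I(1) qindep_iff[OF Is] by (auto simp: free_product_indep_iff)
  then have "int (sdim (n1 + n2) I) \<le> r1 (carrier_vec n1) + r2 ?I2"
    using sdim_split[OF Is] by (simp add: qindep_def)
  moreover have "?I2 \<subseteq> B" using I(2) by (auto simp: cylinder_def)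
  then have "r2 ?I2 \<le> r2 B"
    by (intro qmatroidD(3)[OF M2] linmap_image_subspace[OF linmap_vec_last Is] B)
  ultimately show "r (cylinder n1 n2 B) \<le> r1 (carrier_vec n1) + r2 B"
    using I by (simp add: qindep_def)
next
  obtain J where J: "qindep n1 r1 J" "r1 J = r1 (carrier_vec n1)"
    using qmatroid_exists_basis[OF M1 carrier_subspace] by blast
  obtain B' where B': "qindep n2 r2 B'" "B' \<subseteq> B" "r2 B' = r2 B"
    using qmatroid_exists_basis[OF M2 B] .
  have Js: "J \<in> subspaces n1" and Bs: "B' \<in> subspaces n2" using J B' by (simp_all add: qindep_def)
  \<comment> \<open>The direct sum of \<open>J\<close> and \<open>B'\<close>, with fibre
    \<open>J\<close> and projection \<open>B'\<close>. Here \<open>J\<close> has colevel zero and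
    \<open>B'\<close> has nullity zero, so the defining inequality holds with equality.\<close>
  define I where "I = {v \<in> cylinder n1 n2 B'. vec_first v n1 \<in> J}"
  have Is: "I \<in> subspaces (n1 + n2)"
    unfolding I_def using linmap_vimage[OF field_hom_id linmap_vec_first _ cylinder_subspace[OF Bs]] Js
    by (simp add: subspaces_eq_hsubspaces)
  have app: "u @\<^sub>v w \<in> I \<and> vec_last (u @\<^sub>v w) n2 = w" if "u \<in> J" "w \<in> B'" for u w
  proof -
    have "u \<in> carrier_vec n1" "w \<in> carrier_vec n2"
      using that subspaceD(1)[OF Js] subspaceD(1)[OF Bs] by auto
    then show ?thesis using that
      by (simp add: I_def cylinder_def vec_first_append vec_last_append)
  qed
  have I1: "fiber1 n1 n2 I = J"
    using subspaceD(1)[OF Js] subspaceD(2)[OF Bs]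
    by (auto simp: fiber1_def I_def cylinder_def vec_first_emb1 vec_last_emb1
        linmapD(1)[OF linmap_emb1])
  have I2: "(\<lambda>v. vec_last v n2) ` I = B'"
    using app[OF subspaceD(2)[OF Js]] by (auto simp: I_def cylinder_def image_iff) metis
  have "qindep (n1 + n2) r I"
    using qindep_iff[OF Is] J B' by (simp add: free_product_indep_iff I1 I2 qindep_def)
  then have "r I = r1 J + r2 B'"
    using sdim_split[OF Is] J B' by (simp add: qindep_def I1 I2)
  moreover have "r I \<le> r (cylinder n1 n2 B)"
    using B'(2) by (intro qmatroidD(3)[OF M] Is cylinder_subspace B) (auto simp: I_def cylinder_def)
  ultimately show "r1 (carrier_vec n1) + r2 B \<le> r (cylinder n1 n2 B)" using J B' by simp
qed

text \<open>For an independent fibre, rank and dimension of the fibre agree, so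
  \<open>sdim_split\<close> turns the comparison of colevel and nullity into a bound on the
  dimension of \<open>I\<close>. This form can be tested on matrices.\<close>

lemma qindepI:
  assumes "I \<in> subspaces (n1 + n2)" and "qindep n1 r1 (fiber1 n1 n2 I)"
    and "int (sdim (n1 + n2) I) \<le> r1 (carrier_vec n1) + r2 ((\<lambda>v. vec_last v n2) ` I)"
  shows "qindep (n1 + n2) r I"
  using assms qindep_iff[OF assms(1)] sdim_split[OF assms(1)]
  by (simp add: free_product_indep_iff qindep_def)

end

section \<open>Block upper triangular matrices\<close>

lemma block_upper_carrier:
  assumes "G1 \<in> carrier_mat k1 n1" "G2 \<in> carrier_mat k2 n2" "X \<in> carrier_mat k1 n2"
  shows "block_upper G1 X G2 \<in> carrier_mat (k1 + k2) (n1 + n2)"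
  using assms by (auto simp: block_upper_def)

lemma colmap_block_append:
  assumes h: "field_hom h"
    and G: "G1 \<in> carrier_mat k1 n1" "G2 \<in> carrier_mat k2 n2" "X \<in> carrier_mat k1 n2"
    and u: "u \<in> carrier_vec n1" and w: "w \<in> carrier_vec n2"
  shows "colmap h (block_upper G1 X G2) (u @\<^sub>v w) =
    (colmap h G1 u + colmap h X w) @\<^sub>v colmap h G2 w"
proof -
  have 1: "map_vec h (u @\<^sub>v w) = map_vec h u @\<^sub>v map_vec h w" using u w by (intro eq_vecI) auto
  have hu: "map_vec h u \<in> carrier_vec n1" and hw: "map_vec h w \<in> carrier_vec n2" using u w by simp_all
  have "0\<^sub>m k2 n1 *\<^sub>v map_vec h u + G2 *\<^sub>v map_vec h w = G2 *\<^sub>v map_vec h w"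
    using G(2) hu hw by (intro eq_vecI) auto
  then show ?thesis
    using four_block_mat_mult_vec[OF G(1,3) _ G(2) hu hw, of "0\<^sub>m k2 n1"] G
    unfolding colmap_def block_upper_def 1 by auto
qed

lemma colmap_carrier:
  "field_hom h \<Longrightarrow> G \<in> carrier_mat k n \<Longrightarrow> u \<in> carrier_vec n \<Longrightarrow> colmap h G u \<in> carrier_vec k"
  using linmapD(1)[OF linmap_colmap] .

lemma colmap_block_emb1:
  assumes h: "field_hom h"
    and G: "G1 \<in> carrier_mat k1 n1" "G2 \<in> carrier_mat k2 n2" "X \<in> carrier_mat k1 n2"
    and u: "u \<in> carrier_vec n1"
  shows "colmap h (block_upper G1 X G2) (emb1 n2 u) = emb1 k2 (colmap h G1 u)"
  using colmap_block_append[OF h G u zero_carrier_vec] colmap_carrier[OF h G(1) u]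
    linmap_zero[OF h linmap_colmap[OF h G(2)]] linmap_zero[OF h linmap_colmap[OF h G(3)]]
  by (simp add: emb1_def)

lemma vec_last_colmap_block:
  assumes h: "field_hom h"
    and G: "G1 \<in> carrier_mat k1 n1" "G2 \<in> carrier_mat k2 n2" "X \<in> carrier_mat k1 n2"
    and v: "v \<in> carrier_vec (n1 + n2)"
  shows "vec_last (colmap h (block_upper G1 X G2) v) k2 = colmap h G2 (vec_last v n2)"
proof -
  have "colmap h G1 (vec_first v n1) + colmap h X (vec_last v n2) \<in> carrier_vec k1"
    using colmap_carrier[OF h G(1)] colmap_carrier[OF h G(3)] by simp
  moreover have "colmap h G2 (vec_last v n2) \<in> carrier_vec k2"
    using colmap_carrier[OF h G(2)] by simp
  ultimately show ?thesis
    using colmap_block_append[OF h G vec_first_carrier vec_last_carrier, of v v]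
      vec_first_last_append[OF v] vec_last_append by simp
qed

text \<open>On vectors supported in the first \<open>n1\<close> coordinates only \<open>G1\<close>
  acts, and the result vanishes in the last \<open>k2\<close> coordinates. The value is the same for
  every \<open>X\<close>.\<close>

lemma colrank_block_emb1:
  assumes h: "field_hom h"
    and G: "G1 \<in> carrier_mat k1 n1" "G2 \<in> carrier_mat k2 n2" "X \<in> carrier_mat k1 n2"
    and A: "A \<in> subspaces n1"
  shows "colrank h (block_upper G1 X G2) (emb1 n2 ` A) = colrank h G1 A"
proof -
  let ?B = "block_upper G1 X G2"
  have "colmap h ?B ` emb1 n2 ` A = emb1 k2 ` colmap h G1 ` A"
    unfolding image_image
  proof (rule image_cong[OF refl])
    show "colmap h ?B (emb1 n2 u) = emb1 k2 (colmap h G1 u)" if "u \<in> A" for u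
      using that subspaceD(1)[OF A] by (intro colmap_block_emb1[OF h G]) blast
  qed
  moreover have C: "colmap h G1 ` A \<subseteq> carrier_vec k1"
    using colmap_carrier[OF h G(1)] subspaceD(1)[OF A] by blast
  moreover have "dim_row ?B = k1 + k2" "dim_row G1 = k1"
    using block_upper_carrier[OF G] G(1) by auto
  ultimately show ?thesis
    unfolding colrank_def by (simp add: gspan_linmap[OF linmap_emb1] sdim_emb1 gspan_subspace)
qed

text \<open>Full rank of \<open>G1\<close> forces the column span to contain all vectors supported
  in the first \<open>k1\<close> coordinates. What remains is its projection to the last
  \<open>k2\<close> coordinates, where only \<open>G2\<close> acts; again \<open>X\<close> does not
  affect the value.\<close>

lemma colrank_block_cylinder:
  fixes h :: "'q::{field,finite} \<Rightarrow> 'k::{field,finite}"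
  assumes h: "field_hom h"
    and G: "G1 \<in> carrier_mat k1 n1" "G2 \<in> carrier_mat k2 n2" "X \<in> carrier_mat k1 n2"
    and full: "colrank h G1 (carrier_vec n1) = k1"
    and C: "C \<in> subspaces n2"
  shows "colrank h (block_upper G1 X G2) (cylinder n1 n2 C) = k1 + colrank h G2 C"
proof -
  let ?B = "block_upper G1 X G2" and ?last = "\<lambda>v. vec_last v k2"
  note B = block_upper_carrier[OF G]
  have dims: "dim_row ?B = k1 + k2" "dim_row G1 = k1" "dim_row G2 = k2"
    using B G by auto
  define T where "T = colmap h ?B ` cylinder n1 n2 C"
  have T: "T \<subseteq> carrier_vec (k1 + k2)"
    unfolding T_def using colmap_carrier[OF h B] by (auto simp: cylinder_def)
  define S where "S = gspan (k1 + k2) T"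
  have S: "S \<in> subspaces (k1 + k2)" "T \<subseteq> S"
    unfolding S_def using gspan_subspace[OF T] subset_gspan[OF T] .
  \<comment> \<open>The fibre contains the images under \<open>G1\<close>, and these span a space of
    dimension \<open>k1\<close>.\<close>
  have "fiber1 k1 k2 S = carrier_vec k1"
  proof (rule subspace_eqI[OF fiber1_subspace[OF S(1)] carrier_subspace])
    show sub: "fiber1 k1 k2 S \<subseteq> carrier_vec k1" by (auto simp: fiber1_def)
    have G1C: "colmap h G1 ` carrier_vec n1 \<subseteq> carrier_vec k1"
      using colmap_carrier[OF h G(1)] by blast
    have "colmap h G1 ` carrier_vec n1 \<subseteq> fiber1 k1 k2 S"
    proof clarify
      fix u :: "'q vec" assume u: "u \<in> carrier_vec n1"
      have "emb1 n2 u \<in> cylinder n1 n2 C"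
        using u subspaceD(2)[OF C] linmapD(1)[OF linmap_emb1 u]
        by (simp add: cylinder_def vec_last_emb1)
      then have "emb1 k2 (colmap h G1 u) \<in> T"
        unfolding T_def using colmap_block_emb1[OF h G u] by force
      then show "colmap h G1 u \<in> fiber1 k1 k2 S"
        using S(2) colmap_carrier[OF h G(1) u] by (auto simp: fiber1_def)
    qed
    then have "gspan k1 (colmap h G1 ` carrier_vec n1) \<subseteq> fiber1 k1 k2 S"
      by (intro gspan_least fiber1_subspace S)
    then have "sdim k1 (gspan k1 (colmap h G1 ` carrier_vec n1)) \<le> sdim k1 (fiber1 k1 k2 S)"
      by (intro sdim_mono gspan_subspace[OF G1C] fiber1_subspace S)
    then show "sdim k1 (carrier_vec k1 :: 'k vec set) \<le> sdim k1 (fiber1 k1 k2 S)"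
      using full by (simp add: colrank_def dims sdim_carrier)
  qed
  moreover
  have "(\<lambda>v. vec_last v n2) ` cylinder n1 n2 C = C"
  proof (intro subset_antisym subsetI)
    fix w assume w: "w \<in> C"
    then have wC: "w \<in> carrier_vec n2" using subspaceD(1)[OF C] by blast
    have "vec_last (0\<^sub>v n1 @\<^sub>v w) n2 = w" "0\<^sub>v n1 @\<^sub>v w \<in> carrier_vec (n1 + n2)"
      using wC vec_last_append[OF zero_carrier_vec wC] by auto
    then show "w \<in> (\<lambda>v. vec_last v n2) ` cylinder n1 n2 C"
      using w by (intro image_eqI[of _ _ "0\<^sub>v n1 @\<^sub>v w"]) (auto simp: cylinder_def)
  qed (auto simp: cylinder_def)
  moreover have "?last ` T = colmap h G2 ` (\<lambda>v. vec_last v n2) ` cylinder n1 n2 C"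
    unfolding T_def image_image
    by (intro image_cong refl vec_last_colmap_block[OF h G]) (simp add: cylinder_def)
  ultimately have "fiber1 k1 k2 S = carrier_vec k1" "?last ` S = gspan k2 (colmap h G2 ` C)"
    unfolding S_def using gspan_linmap[OF linmap_vec_last T] by simp_all
  then show ?thesis
    using sdim_split[OF S(1)] by (simp add: colrank_def dims sdim_carrier flip: T_def S_def)
qed

section \<open>Independence with respect to a matrix\<close>

lemma colrank_le_hdim:
  assumes h: "field_hom h" and G: "G \<in> carrier_mat k n" and U: "U \<in> subspaces n"
  shows "colrank h G U \<le> hdim h k (colmap h G ` U)"
proof -
  note L = linmap_colmap[OF h G]
  \<comment> \<open>The bound is the comparison \<open>sdim_gspan_le\<close> started at the zero
    space, where both dimensions vanish.\<close>
  have z: "{0\<^sub>v k} = colmap h G ` {0\<^sub>v n}" using linmap_zero[OF h L] by simp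
  have "hdim h k {0\<^sub>v k} \<le> 0"
    using hdim_linmap_le[OF h L zero_subspace] linmap_zero[OF h L] by (simp add: sdim_zero)
  moreover have "gspan k {0\<^sub>v k} = ({0\<^sub>v k} :: 'b vec set)" by (rule gspan_idem[OF zero_subspace])
  moreover have "{0\<^sub>v k} \<in> hsubspaces h k" by (rule subspace_hsubspace[OF h zero_subspace])
  moreover have "{0\<^sub>v k} \<subseteq> colmap h G ` U" using z subspaceD(2)[OF U] by auto
  ultimately show ?thesis
    using sdim_gspan_le[OF h linmap_image[OF h L U], of "{0\<^sub>v k}"] G
    by (simp add: colrank_def sdim_zero)
qed

text \<open>In general \<open>colrank h G I\<close> is at most the F_q-dimension of the image, which
  is at most the dimension of \<open>I\<close>. Independence means equality in both places: no
  kernel on \<open>I\<close>, and an image that keeps its dimension over the extension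
  field.\<close>

lemma colrank_indep_iff:
  fixes h :: "'q::{field,finite} \<Rightarrow> 'k::{field,finite}"
  assumes h: "field_hom h" and G: "G \<in> carrier_mat k n" and I: "I \<in> subspaces n"
  shows "colrank h G I = sdim n I \<longleftrightarrow>
    inj_on (colmap h G) I \<and> colrank h G I = hdim h k (colmap h G ` I)"
proof
  note L = linmap_colmap[OF h G]
  assume eq: "colrank h G I = sdim n I"
  then have e: "hdim h k (colmap h G ` I) = sdim n I"
    using colrank_le_hdim[OF h G I] hdim_linmap_le[OF h L I] by simp
  then have "card (colmap h G ` I) = card I"
    using card_hsubspace[OF h linmap_image[OF h L I]] card_subspace[OF I] by simp
  moreover have "finite I"
    using finite_hsubspace[OF field_hom_id] I by (simp add: subspaces_eq_hsubspaces)
  ultimately show "inj_on (colmap h G) I \<and> colrank h G I = hdim h k (colmap h G ` I)"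
    using e eq by (simp add: eq_card_imp_inj_on)
next
  assume "inj_on (colmap h G) I \<and> colrank h G I = hdim h k (colmap h G ` I)"
  then show "colrank h G I = sdim n I"
    using hdim_linmap_inj[OF h linmap_colmap[OF h G] I] by simp
qed

text \<open>By \<open>sdim_gspan_le\<close> the drop from the F_q-dimension of the image to
  \<open>colrank\<close> is no larger on a subspace; it is zero on \<open>I\<close>, hence zero on
  \<open>J\<close>.\<close>

lemma colrank_indep_subset:
  assumes h: "field_hom h" and G: "G \<in> carrier_mat k n"
    and I: "I \<in> subspaces n" "colrank h G I = sdim n I" and J: "J \<in> subspaces n" "J \<subseteq> I"
  shows "colrank h G J = sdim n J"
proof -
  note L = linmap_colmap[OF h G]
  have i: "inj_on (colmap h G) I" "colrank h G I = hdim h k (colmap h G ` I)"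
    using colrank_indep_iff[OF h G I(1)] I(2) by blast+
  have "colrank h G I + hdim h k (colmap h G ` J) \<le> colrank h G J + hdim h k (colmap h G ` I)"
    using sdim_gspan_le[OF h linmap_image[OF h L I(1)] linmap_image[OF h L J(1)] image_mono[OF J(2)]] G
    by (simp add: colrank_def)
  then have "colrank h G J = hdim h k (colmap h G ` J)"
    using i(2) colrank_le_hdim[OF h G J(1)] by simp
  then show ?thesis
    using colrank_indep_iff[OF h G J(1)] inj_on_subset[OF i(1) J(2)] by blast
qed

section \<open>Change of basis to block upper triangular form\<close>

lemma mat_of_cols_append_mult:
  fixes vs :: "'a::field vec list"
  assumes x: "x \<in> carrier_vec (length vs)" and y: "y \<in> carrier_vec (length ws)"
  shows "mat_of_cols k (vs @ ws) *\<^sub>v (x @\<^sub>v y) = mat_of_cols k vs *\<^sub>v x + mat_of_cols k ws *\<^sub>v y"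
proof (rule eq_vecI)
  fix i assume "i < dim_vec (mat_of_cols k vs *\<^sub>v x + mat_of_cols k ws *\<^sub>v y)"
  then have i: "i < k" by simp
  have "row (mat_of_cols k (vs @ ws)) i = row (mat_of_cols k vs) i @\<^sub>v row (mat_of_cols k ws) i"
    using i by (intro eq_vecI) (auto simp: mat_of_cols_index nth_append)
  moreover have "row (mat_of_cols k vs) i \<in> carrier_vec (length vs)"
    "row (mat_of_cols k ws) i \<in> carrier_vec (length ws)" by (auto intro: carrier_vecI)
  ultimately show "(mat_of_cols k (vs @ ws) *\<^sub>v (x @\<^sub>v y)) $ i =
      (mat_of_cols k vs *\<^sub>v x + mat_of_cols k ws *\<^sub>v y) $ i"
    using i scalar_prod_append[OF _ _ x y] by simp
qed simp

lemma linmap_mult_mat_vec: "A \<in> carrier_mat k n \<Longrightarrow> linmap (\<lambda>x. x) n k ((*\<^sub>v) A)"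
  by (auto simp: linmap_def mult_add_distrib_mat_vec mult_mat_vec)

text \<open>Vectors of \<open>W\<close> outside the current image are appended one at a time. Linear
  independence is encoded as injectivity of the matrix on coordinate vectors, so a completed basis
  appears as a bijection onto \<open>W\<close>.\<close>

lemma extend_to_basis:
  fixes W :: "'a::{field,finite} vec set"
  assumes W: "W \<in> subspaces k"
  shows "(*\<^sub>v) (mat_of_cols k vs) ` carrier_vec (length vs) \<subseteq> W \<Longrightarrow> inj_on ((*\<^sub>v) (mat_of_cols k vs)) (carrier_vec (length vs)) \<Longrightarrow>
    \<exists>ws. bij_betw ((*\<^sub>v) (mat_of_cols k (vs @ ws))) (carrier_vec (length (vs @ ws))) W"
proof (induction "sdim k W - length vs" arbitrary: vs rule: less_induct)
  case less
  let ?M = "mat_of_cols k vs" and ?C = "carrier_vec (length vs) :: 'a vec set"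
  let ?I = "(*\<^sub>v) ?M ` ?C"
  have L: "linmap (\<lambda>x. x) (length vs) k ((*\<^sub>v) ?M)" by (intro linmap_mult_mat_vec) simp
  have I: "?I \<in> subspaces k" by (rule linmap_image_subspace[OF L carrier_subspace])
  note IW = less.prems(1)
  have dI: "sdim k ?I = length vs"
    using sdim_linmap_inj[OF L carrier_subspace less.prems(2)] by (simp add: sdim_carrier)
  show ?case
  proof (cases "?I = W")
    case True
    then show ?thesis using less.prems(2) by (intro exI[of _ "[]"]) (simp add: bij_betw_def)
  next
    case False
    then obtain v where v: "v \<in> W" "v \<notin> ?I" using IW by blast
    have vC: "v \<in> carrier_vec k" using v subspaceD(1)[OF W] by blast
    \<comment> \<open>The strict inequality makes the truncated difference in the induction measure
      really decrease.\<close>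
    have "length vs < sdim k W"
      using False subspace_eqI[OF I W IW] dI by force
    then have m: "sdim k W - length (vs @ [v]) < sdim k W - length vs" by simp
    let ?M' = "mat_of_cols k (vs @ [v])"
    have L': "linmap (\<lambda>x. x) (length vs + 1) k ((*\<^sub>v) ?M')"
      by (intro linmap_mult_mat_vec) (simp add: mat_of_cols_def)
    have split: "?M' *\<^sub>v z = ?M *\<^sub>v vec_first z (length vs) + (vec_last z 1 $ 0) \<cdot>\<^sub>v v"
      if z: "z \<in> carrier_vec (length vs + 1)" for z
    proof -
      have "mat_of_cols k [v] *\<^sub>v vec_last z 1 = (vec_last z 1 $ 0) \<cdot>\<^sub>v v"
        using vC by (intro eq_vecI) (auto simp: scalar_prod_def mat_of_cols_index)
      then show ?thesis
        using mat_of_cols_append_mult[of "vec_first z (length vs)" vs "vec_last z 1" "[v]" k]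
          vec_first_last_append[OF z] by simp
    qed
    have "(*\<^sub>v) ?M' ` carrier_vec (length vs + 1) \<subseteq> W"
    proof (rule image_subsetI)
      fix z :: "'a vec" assume z: "z \<in> carrier_vec (length vs + 1)"
      have "?M *\<^sub>v vec_first z (length vs) \<in> W" using IW by auto
      then show "?M' *\<^sub>v z \<in> W"
        unfolding split[OF z] using v(1) by (intro subspaceD(3,4)[OF W])
    qed
    moreover have "inj_on ((*\<^sub>v) ?M') (carrier_vec (length vs + 1))"
    proof (rule linmap_inj_on[OF field_hom_id L' carrier_subspace])
      fix z assume z: "z \<in> carrier_vec (length vs + 1)" and 0: "?M' *\<^sub>v z = 0\<^sub>v k"
      define x c where "x = vec_first z (length vs)" and "c = vec_last z 1 $ 0"
      have x: "x \<in> ?C" and zz: "z = x @\<^sub>v vec_last z 1"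
        using z by (simp_all add: x_def)
      have e: "?M *\<^sub>v x + c \<cdot>\<^sub>v v = 0\<^sub>v k" using 0 split[OF z] by (simp add: x_def c_def)
      have Mx: "?M *\<^sub>v x \<in> carrier_vec k" using linmapD(1)[OF L x] .
      \<comment> \<open>A nonzero coefficient would express \<open>v\<close> through the earlier
        vectors.\<close>
      have c: "c = 0"
      proof (rule ccontr)
        assume "c \<noteq> 0"
        have "v = (- inverse c) \<cdot>\<^sub>v (?M *\<^sub>v x)"
        proof (rule eq_vecI)
          fix i assume "i < dim_vec ((- inverse c) \<cdot>\<^sub>v (?M *\<^sub>v x))"
          then have i: "i < k" by simp
          then have "(?M *\<^sub>v x) $ i + c * v $ i = 0"
            using arg_cong[OF e, of "\<lambda>w. w $ i"] Mx vC by simp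
          then have "(?M *\<^sub>v x) $ i = - (c * v $ i)" by (simp add: eq_neg_iff_add_eq_0)
          then show "v $ i = ((- inverse c) \<cdot>\<^sub>v (?M *\<^sub>v x)) $ i"
            using i Mx \<open>c \<noteq> 0\<close> by (simp del: index_mult_mat_vec)
        qed (use vC in simp)
        then show False using v(2) subspaceD(4)[OF I, of "?M *\<^sub>v x"] x by (metis imageI)
      qed
      moreover have "0 \<cdot>\<^sub>v v = 0\<^sub>v k" using vC by (intro eq_vecI) auto
      ultimately have "?M *\<^sub>v x = 0\<^sub>v k" using e Mx by simp
      then have "x = 0\<^sub>v (length vs)"
        using inj_onD[OF less.prems(2), of x "0\<^sub>v (length vs)"] x linmap_zero[OF field_hom_id L] by simp
      moreover have "vec_last z 1 = 0\<^sub>v 1" using c by (intro eq_vecI) (auto simp: c_def)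
      moreover have "0\<^sub>v (length vs) @\<^sub>v 0\<^sub>v 1 = (0\<^sub>v (length vs + 1) :: 'a vec)" by auto
      ultimately show "z = 0\<^sub>v (length vs + 1)" using zz by simp
    qed
    ultimately have "\<exists>ws. bij_betw ((*\<^sub>v) (mat_of_cols k ((vs @ [v]) @ ws))) (carrier_vec (length ((vs @ [v]) @ ws))) W"
      by (intro less.hyps[OF m]) auto
    then show ?thesis by (metis append_assoc)
  qed
qed


lemma unit_vec_append:
  "j < n \<Longrightarrow> emb1 m (unit_vec n j) = unit_vec (n + m) j"
  by (auto simp: emb1_def intro!: eq_vecI)

lemma colmap_unit_vec:
  assumes "field_hom h" "G \<in> carrier_mat k n" "j < n"
  shows "colmap h G (unit_vec n j) = col G j"
proof -
  interpret field_hom h by fact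
  have "map_vec h (unit_vec n j) = unit_vec n j" by (intro eq_vecI) (auto simp: unit_vec_def)
  then show ?thesis
    using assms by (auto simp: colmap_def scalar_prod_right_unit intro!: eq_vecI)
qed

text \<open>A basis of \<open>W\<close> is extended to a basis of the whole space. With these
  vectors as columns of \<open>Q\<close>, the first \<open>k1\<close> coordinates parametrise
  \<open>W\<close>.\<close>

lemma exists_adapted_basis:
  fixes W :: "'a::{field,finite} vec set"
  assumes W: "W \<in> subspaces k" and k1: "sdim k W = k1"
  obtains k2 Q where "k = k1 + k2" and "Q \<in> carrier_mat k k"
    and "bij_betw ((*\<^sub>v) Q) (carrier_vec k) (carrier_vec k)"
    and "(*\<^sub>v) Q ` emb1 k2 ` carrier_vec k1 = W"
proof -
  have dim: "length vs = sdim k V"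
    if "bij_betw ((*\<^sub>v) (mat_of_cols k vs)) (carrier_vec (length vs)) V" for vs and V :: "'a vec set"
  proof -
    have "linmap (\<lambda>x. x) (length vs) k ((*\<^sub>v) (mat_of_cols k vs))"
      by (intro linmap_mult_mat_vec) simp
    from sdim_linmap_inj[OF this carrier_subspace] that show ?thesis
      by (simp add: sdim_carrier bij_betw_def)
  qed
  have c0: "carrier_vec 0 = {0\<^sub>v 0 :: 'a vec}" by (auto intro: eq_vecI)
  \<comment> \<open>The extension starts from the empty list, whose only coordinate vector is sent
    to zero.\<close>
  have "mat_of_cols k [] *\<^sub>v 0\<^sub>v 0 = (0\<^sub>v k :: 'a vec)"
    by (intro eq_vecI) (auto simp: scalar_prod_def)
  then obtain vs where vs: "bij_betw ((*\<^sub>v) (mat_of_cols k vs)) (carrier_vec (length vs)) W"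
    using extend_to_basis[OF W, of "[]"] subspaceD(2)[OF W] c0 by auto
  have lv: "length vs = k1" using dim[OF vs] k1 by simp
  have "(*\<^sub>v) (mat_of_cols k vs) ` carrier_vec (length vs) \<subseteq> carrier_vec k"
    using subspaceD(1)[OF W] vs by (simp add: bij_betw_def)
  then obtain ws where ws: "bij_betw ((*\<^sub>v) (mat_of_cols k (vs @ ws)))
      (carrier_vec (length (vs @ ws))) (carrier_vec k)"
    using extend_to_basis[OF carrier_subspace, of k vs] vs unfolding bij_betw_def by blast
  have lw: "length (vs @ ws) = k" using dim[OF ws] by (simp add: sdim_carrier)
  let ?Q = "mat_of_cols k (vs @ ws)"
  have e: "?Q *\<^sub>v emb1 (length ws) x = mat_of_cols k vs *\<^sub>v x"
    if x: "x \<in> carrier_vec k1" for x :: "'a vec"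
  proof -
    have "mat_of_cols k ws *\<^sub>v 0\<^sub>v (length ws) = (0\<^sub>v k :: 'a vec)" by (intro eq_vecI) auto
    moreover have "mat_of_cols k vs *\<^sub>v x \<in> carrier_vec k" by (intro carrier_vecI) simp
    ultimately show ?thesis
      using mat_of_cols_append_mult[OF x[folded lv] zero_carrier_vec, of k ws] by (simp add: emb1_def)
  qed
  show thesis
  proof (rule that)
    show "k = k1 + length ws" using lv lw by simp
    show "?Q \<in> carrier_mat k k" using lw by (intro carrier_matI) simp_all
    show "bij_betw ((*\<^sub>v) ?Q) (carrier_vec k) (carrier_vec k)" using ws unfolding lw .
    have "(*\<^sub>v) ?Q ` emb1 (length ws) ` carrier_vec k1 = (*\<^sub>v) (mat_of_cols k vs) ` carrier_vec k1"
      unfolding image_image by (intro image_cong refl e)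
    also have "\<dots> = W" using vs lv by (simp add: bij_betw_def)
    finally show "(*\<^sub>v) ?Q ` emb1 (length ws) ` carrier_vec k1 = W" .
  qed
qed

text \<open>The columns of \<open>G\<close> are rewritten in a basis adapted to the span of the
  first \<open>n1\<close> columns. In these coordinates the first \<open>n1\<close> columns vanish
  below row \<open>k1\<close>, and an invertible change of basis preserves every column
  rank.\<close>

lemma block_upper_form:
  fixes h :: "'q::{field,finite} \<Rightarrow> 'k::{field,finite}"
  assumes h: "field_hom h" and G: "G \<in> carrier_mat k (n1 + n2)"
    and k1: "colrank h G (emb1 n2 ` carrier_vec n1) = k1"
  obtains k2 G1 X G2 where "k = k1 + k2"
    and "G1 \<in> carrier_mat k1 n1" "G2 \<in> carrier_mat k2 n2" "X \<in> carrier_mat k1 n2"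
    and "\<forall>U\<in>subspaces (n1 + n2). colrank h (block_upper G1 X G2) U = colrank h G U"
proof -
  let ?n = "n1 + n2"
  define T where "T = colmap h G ` emb1 n2 ` carrier_vec n1"
  have TC: "T \<subseteq> carrier_vec k"
    unfolding T_def using colmap_carrier[OF h G] linmapD(1)[OF linmap_emb1] by blast
  have dT: "sdim k (gspan k T) = k1" using k1 G by (simp add: colrank_def T_def)
  obtain k2 Q where kk: "k = k1 + k2" and Q: "Q \<in> carrier_mat k k"
    and bij: "bij_betw ((*\<^sub>v) Q) (carrier_vec k) (carrier_vec k)"
    and W: "(*\<^sub>v) Q ` emb1 k2 ` carrier_vec k1 = gspan k T"
    by (rule exists_adapted_basis[OF gspan_subspace[OF TC] dT])
  \<comment> \<open>The coordinate map of the new basis, taken as a set-theoretic inverse of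
    multiplication by \<open>Q\<close>; no inverse matrix is formed.\<close>
  define q where "q = inv_into (carrier_vec k) ((*\<^sub>v) Q)"
  have q: "q y \<in> carrier_vec k" "Q *\<^sub>v q y = y" if "y \<in> carrier_vec k" for y
    unfolding q_def using that bij
    by (simp_all add: bij_betw_def inv_into_into f_inv_into_f)
  define R where "R = mat_of_cols k (map (\<lambda>j. q (col G j)) [0..<?n])"
  have R: "R \<in> carrier_mat k ?n" by (simp add: R_def mat_of_cols_def)
  have colG: "col G j \<in> carrier_vec k" for j using G by (simp add: carrier_vecI)
  have colR: "col R j = q (col G j)" if "j < ?n" for j
    using that q(1)[OF colG] by (simp add: R_def)
  have QR: "Q * R = G"
  proof (rule mat_col_eqI)
    fix j assume "j < dim_col G"
    then have j: "j < ?n" using G by simp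
    show "col (Q * R) j = col G j"
      using col_mult2[OF Q R j] colR[OF j] q(2)[OF colG] by simp
  qed (use Q R G in auto)
  \<comment> \<open>Column \<open>j\<close> of \<open>G\<close> is the image of a unit vector of the
    first summand, so it lies in the subspace parametrised by the first \<open>k1\<close>
    coordinates.\<close>
  have lowz: "R $$ (i, j) = 0" if i: "k1 \<le> i" "i < k" and j: "j < n1" for i j
  proof -
    have "colmap h G (emb1 n2 (unit_vec n1 j)) \<in> T" unfolding T_def by simp
    then have "col G j \<in> T"
      using j colmap_unit_vec[OF h G, of j] by (simp add: unit_vec_append)
    then have "col G j \<in> (*\<^sub>v) Q ` emb1 k2 ` carrier_vec k1"
      unfolding W using subset_gspan[OF TC] by blast
    then obtain x where x: "x \<in> carrier_vec k1" "col G j = Q *\<^sub>v emb1 k2 x" by blast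
    have "emb1 k2 x \<in> carrier_vec k" using linmapD(1)[OF linmap_emb1 x(1)] kk by simp
    then have "q (col G j) = emb1 k2 x"
      unfolding x(2) q_def using bij by (intro inv_into_f_f) (simp_all add: bij_betw_def)
    then have "col R j = emb1 k2 x" using colR j by simp
    then have "col R j $ i = 0" using i kk x(1) by (simp add: emb1_def)
    then show ?thesis using R i j by simp
  qed
  obtain G1 X C G2 where sp: "split_block R k1 n1 = (G1, X, C, G2)" by (metis prod_cases4)
  have dR: "dim_row R = k1 + k2" "dim_col R = n1 + n2" using R kk by simp_all
  note blk = split_block[OF sp dR]
  have "C = 0\<^sub>m k2 n1"
  proof (rule eq_matI)
    fix i j assume "i < dim_row (0\<^sub>m k2 n1 :: 'k mat)" "j < dim_col (0\<^sub>m k2 n1 :: 'k mat)"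
    then have ij: "i < k2" "j < n1" by simp_all
    have "C $$ (i, j) = R $$ (i + k1, j)"
      using ij sp dR unfolding split_block_def Let_def by auto
    then show "C $$ (i, j) = (0\<^sub>m k2 n1 :: 'k mat) $$ (i, j)" using ij lowz[of "i + k1" j] kk by simp
  qed (use blk in auto)
  then have Rb: "R = block_upper G1 X G2" using blk by (simp add: block_upper_def)
  have "colrank h R U = colrank h G U" if U: "U \<in> subspaces ?n" for U
  proof -
    have LQ: "linmap (\<lambda>x. x) k k ((*\<^sub>v) Q)" by (rule linmap_mult_mat_vec[OF Q])
    have C: "colmap h R ` U \<subseteq> carrier_vec k"
      using colmap_carrier[OF h R] subspaceD(1)[OF U] by blast
    have "colmap h G u = Q *\<^sub>v colmap h R u" if "u \<in> U" for u
      unfolding colmap_def QR[symmetric]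
      using that subspaceD(1)[OF U] by (intro assoc_mult_mat_vec[OF Q R]) auto
    then have "colmap h G ` U = (*\<^sub>v) Q ` colmap h R ` U"
      unfolding image_image by (intro image_cong refl)
    then have "gspan k (colmap h G ` U) = (*\<^sub>v) Q ` gspan k (colmap h R ` U)"
      using gspan_linmap[OF LQ C] by simp
    moreover have "inj_on ((*\<^sub>v) Q) (gspan k (colmap h R ` U))"
      using bij subspaceD(1)[OF gspan_subspace[OF C]] by (meson bij_betw_def inj_on_subset)
    ultimately show ?thesis
      using sdim_linmap_inj[OF LQ gspan_subspace[OF C]] R G by (simp add: colrank_def)
  qed
  then show thesis by (intro that[OF kk blk(1,4,2)]) (simp flip: Rb)
qed

section \<open>Counting dimension preserving subspaces\<close>

lemma gspan_unit_vecs: "gspan n (set (unit_vecs n)) = (carrier_vec n :: 'a::field vec set)"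
proof -
  interpret vec_space "TYPE('a)" n .
  show ?thesis by (rule span_unit_vecs_is_carrier)
qed

lemma colmap_unit_vecs:
  assumes "field_hom h" "G \<in> carrier_mat k n"
  shows "colmap h G ` set (unit_vecs n) = set (cols G)"
proof -
  have "colmap h G ` set (unit_vecs n) = (\<lambda>j. colmap h G (unit_vec n j)) ` {..<n}"
    unfolding unit_vecs_def by (simp add: image_image atLeast0LessThan)
  also have "\<dots> = (\<lambda>j. col G j) ` {..<n}"
    using assms by (intro image_cong refl colmap_unit_vec) auto
  also have "\<dots> = set (cols G)"
    using assms(2) by (simp add: cols_def atLeast0LessThan)
  finally show ?thesis .
qed

lemma unit_vecs_subset: "set (unit_vecs n) \<subseteq> carrier_vec n"
  by (auto simp: unit_vecs_def)

lemma rank_eq_colrank: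
  fixes h :: "'q::{field,finite} \<Rightarrow> 'k::{field,finite}"
  assumes h: "field_hom h" and G: "G \<in> carrier_mat k n"
  shows "vec_space.rank k G = colrank h G (carrier_vec n)"
  using gspan_image_gspan[OF h linmap_colmap[OF h G] unit_vecs_subset] G
  by (simp add: gspan_unit_vecs colmap_unit_vecs[OF h G] rank_eq_sdim_gspan colrank_def)

text \<open>The unit vectors generate the domain and are sent to the columns. Each inclusion holds
  because a span is the least subspace containing its generators.\<close>

lemma col_span_eq:
  fixes h :: "'q::{field,finite} \<Rightarrow> 'k::{field,finite}"
  assumes h: "field_hom h" and G: "G \<in> carrier_mat k n"
  shows "col_span h G = colmap h G ` carrier_vec n"
proof -
  interpret vectorspace class_ring "restricted_vec h k" by (rule vectorspace_restricted_vec[OF h])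
  note L = linmap_colmap[OF h G]
  have C: "set (cols G) \<subseteq> carrier (restricted_vec h k)"
    using cols_dim[of G] G by (simp add: restricted_vec_def)
  have s: "span (set (cols G)) \<in> hsubspaces h k" "set (cols G) \<subseteq> span (set (cols G))"
    using span_is_subspace[OF C] in_own_span[OF C] by (simp_all add: hsubspaces_def)
  have im: "colmap h G ` carrier_vec n \<in> hsubspaces h k"
    by (rule linmap_image[OF h L carrier_subspace])
  have "span (set (cols G)) \<subseteq> colmap h G ` carrier_vec n"
  proof (rule span_is_subset)
    show "set (cols G) \<subseteq> colmap h G ` carrier_vec n"
      unfolding colmap_unit_vecs[OF h G, symmetric] by (intro image_mono unit_vecs_subset)
    show "submodule class_ring (colmap h G ` carrier_vec n) (restricted_vec h k)"
      using im by (simp add: hsubspaces_def)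
  qed
  moreover have "carrier_vec n \<subseteq> {u \<in> carrier_vec n. colmap h G u \<in> span (set (cols G))}"
    unfolding gspan_unit_vecs[symmetric, of n]
  proof (rule gspan_least)
    show "{u \<in> gspan n (set (unit_vecs n)). colmap h G u \<in> span (set (cols G))} \<in> subspaces n"
      unfolding gspan_unit_vecs by (rule linmap_vimage[OF h L s(1) carrier_subspace])
    show "set (unit_vecs n) \<subseteq> {u \<in> gspan n (set (unit_vecs n)). colmap h G u \<in> span (set (cols G))}"
      unfolding gspan_unit_vecs using unit_vecs_subset colmap_unit_vecs[OF h G] s(2) by blast
  qed
  ultimately show ?thesis using G by (auto simp: col_span_def)
qed

lemma mem_dim_preserved_subspaces:
  fixes h :: "'q::{field,finite} \<Rightarrow> 'k::{field,finite}"
  assumes h: "field_hom h" and G: "G \<in> carrier_mat k n"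
  shows "U \<in> dim_preserved_subspaces h G \<longleftrightarrow> U \<in> hsubspaces h k \<and>
    U \<subseteq> colmap h G ` carrier_vec n \<and> hdim h k U = sdim k (gspan k U)"
  using G col_span_eq[OF h G]
  by (simp add: dim_preserved_subspaces_def hsubspaces_def hdim_def)

text \<open>A largest subspace on which the column map is injective is a complement of its kernel: a
  vector whose value is missed could be adjoined without losing injectivity.\<close>

lemma exists_transversal:
  fixes h :: "'q::{field,finite} \<Rightarrow> 'k::{field,finite}"
  assumes h: "field_hom h" and G: "G \<in> carrier_mat k n"
  obtains C where "C \<in> subspaces n" and "inj_on (colmap h G) C"
    and "colmap h G ` C = colmap h G ` carrier_vec n"
proof -
  let ?f = "colmap h G"
  note L = linmap_colmap[OF h G]
  interpret field_hom h by fact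
  define P where "P C \<longleftrightarrow> C \<in> subspaces n \<and> inj_on ?f C" for C
  have "P {0\<^sub>v n}" by (simp add: P_def zero_subspace)
  moreover have "C \<in> subspaces n" if "P C" for C using that by (simp add: P_def)
  ultimately obtain C where PC: "P C" and Cmax: "\<And>W. P W \<Longrightarrow> sdim n W \<le> sdim n C"
    using subspace_max[of P] by blast
  have C: "C \<in> subspaces n" "inj_on ?f C" using PC by (simp_all add: P_def)
  note CC = subspaceD(1)[OF C(1)]
  have "?f v \<in> ?f ` C" if v: "v \<in> carrier_vec n" for v
  proof (rule ccontr)
    assume nin: "?f v \<notin> ?f ` C"
    let ?A = "adjoin (\<lambda>x. x) C v"
    have A: "?A \<in> subspaces n" "sdim n ?A = Suc (sdim n C)"
      using adjoin_hsubspace(1)[OF field_hom_id _ v, of C] hdim_adjoin[OF field_hom_id _ v, of C] C(1) nin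
      by (auto simp: subspaces_eq_hsubspaces[symmetric] hdim_id_eq_sdim)
    have "inj_on ?f ?A"
    proof (rule linmap_inj_on[OF h L A(1)])
      fix w assume "w \<in> ?A" and 0: "?f w = 0\<^sub>v k"
      then obtain c a where w: "c \<in> C" "w = c + a \<cdot>\<^sub>v v" by (auto simp: adjoin_def)
      have c: "c \<in> carrier_vec n" using w CC by blast
      have fc: "?f c \<in> carrier_vec k" "?f v \<in> carrier_vec k" using linmapD(1)[OF L] c v by blast+
      have e: "?f c + h a \<cdot>\<^sub>v ?f v = 0\<^sub>v k"
        using 0 c v w(2) linmapD(2,3)[OF L] by simp
      \<comment> \<open>Otherwise the value at \<open>v\<close> would be a scalar multiple of a
        value on \<open>C\<close>, hence attained on \<open>C\<close>.\<close>
      have "a = 0"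
      proof (rule ccontr)
        assume a: "a \<noteq> 0"
        have "?f v = h (- inverse a) \<cdot>\<^sub>v ?f c"
        proof (rule eq_vecI)
          fix i assume "i < dim_vec (h (- inverse a) \<cdot>\<^sub>v ?f c)"
          then have i: "i < k" using fc by simp
          then have "?f c $ i + h a * ?f v $ i = 0"
            using arg_cong[OF e, of "\<lambda>w. w $ i"] fc by simp
          then have "?f c $ i = - (h a * ?f v $ i)" by (simp add: eq_neg_iff_add_eq_0)
          then show "?f v $ i = (h (- inverse a) \<cdot>\<^sub>v ?f c) $ i"
            using i fc a by (simp add: hom_uminus hom_inverse)
        qed (use fc in simp)
        also have "\<dots> = ?f ((- inverse a) \<cdot>\<^sub>v c)" using linmapD(3)[OF L c] by simp
        finally show False using nin subspaceD(4)[OF C(1) w(1)] by blast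
      qed
      then have "w = c" using w(2) v c by (intro eq_vecI) auto
      then show "w = 0\<^sub>v n"
        using 0 inj_onD[OF C(2), of c "0\<^sub>v n"] w(1) subspaceD(2)[OF C(1)] linmap_zero[OF h L] by simp
    qed
    then have "P ?A" using A by (simp add: P_def)
    then show False using Cmax A(2) by fastforce
  qed
  then have "?f ` C = ?f ` carrier_vec n" using CC by blast
  then show thesis using that C by blast
qed

text \<open>A line has dimension one, and a nonzero image spans a space of positive dimension. Such
  lines let nonvanishing of the column map pass from one matrix to another through independence
  alone.\<close>

lemma colrank_line:
  fixes h :: "'q::{field,finite} \<Rightarrow> 'k::{field,finite}"
  assumes h: "field_hom h" and G: "G \<in> carrier_mat k n"
    and c: "c \<in> carrier_vec n" and nz: "colmap h G c \<noteq> 0\<^sub>v k"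
  defines "L \<equiv> adjoin (\<lambda>x. x) {0\<^sub>v n} c"
  shows "L \<in> subspaces n" and "c \<in> L" and "colrank h G L = sdim n L"
proof -
  note lin = linmap_colmap[OF h G]
  have z: "{0\<^sub>v n} \<in> hsubspaces (\<lambda>x. x :: 'q) n"
    using zero_subspace by (simp add: subspaces_eq_hsubspaces[symmetric])
  show Ls: "L \<in> subspaces n" "c \<in> L"
    using adjoin_hsubspace[OF field_hom_id z c] unfolding L_def by (simp_all add: subspaces_eq_hsubspaces)
  have "c \<notin> {0\<^sub>v n}" using nz linmap_zero[OF h lin] by auto
  then have "hdim (\<lambda>x. x) n L = Suc 0"
    using hdim_adjoin[OF field_hom_id z c] hdim_id_eq_sdim[OF zero_subspace, of n, where 'a='q]
    unfolding L_def by (simp add: sdim_zero)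
  then have dL: "sdim n L = 1" using hdim_id_eq_sdim[OF Ls(1)] by simp
  let ?S = "gspan k (colmap h G ` L)"
  have C: "colmap h G ` L \<subseteq> carrier_vec k"
    using linmapD(1)[OF lin] subspaceD(1)[OF Ls(1)] by blast
  have S: "?S \<in> subspaces k" "colmap h G c \<in> ?S"
    using gspan_subspace[OF C] subset_gspan[OF C] Ls(2) by blast+
  have "sdim k ?S \<noteq> 0"
  proof
    assume "sdim k ?S = 0"
    then have "{0\<^sub>v k} = ?S"
      using subspaceD(2)[OF S(1)] by (intro subspace_eqI[OF zero_subspace S(1)]) auto
    then show False using S(2) nz by blast
  qed
  moreover have "colrank h G L \<le> sdim n L"
    using colrank_le_hdim[OF h G Ls(1)] hdim_linmap_le[OF h lin Ls(1)] by simp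
  ultimately show "colrank h G L = sdim n L" using dL G by (simp add: colrank_def)
qed

lemma card_dim_preserved_subspaces_mono:
  fixes h :: "'q::{field,finite} \<Rightarrow> 'k::{field,finite}"
  assumes h: "field_hom h" and G: "G \<in> carrier_mat k n" and G': "G' \<in> carrier_mat k n"
    and indep: "\<And>I. I \<in> subspaces n \<Longrightarrow> colrank h G' I = sdim n I \<Longrightarrow> colrank h G I = sdim n I"
  shows "card (dim_preserved_subspaces h G') \<le> card (dim_preserved_subspaces h G)"
proof -
  let ?f = "colmap h G" and ?f' = "colmap h G'"
  note L = linmap_colmap[OF h G] and L' = linmap_colmap[OF h G']
  obtain C where C: "C \<in> subspaces n" "inj_on ?f' C" "?f' ` C = ?f' ` carrier_vec n"
    using exists_transversal[OF h G'] .
  \<comment> \<open>A nonzero \<open>c\<close> in \<open>C\<close> is not killed by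
    \<open>G'\<close>, so its line is independent for \<open>G'\<close>, hence by assumption for
    \<open>G\<close>; thus \<open>G\<close> does not kill \<open>c\<close> either.\<close>
  have inj: "inj_on ?f C"
  proof (rule linmap_inj_on[OF h L C(1)])
    fix c assume c: "c \<in> C" and 0: "?f c = 0\<^sub>v k"
    have cC: "c \<in> carrier_vec n" using c subspaceD(1)[OF C(1)] by blast
    show "c = 0\<^sub>v n"
    proof (cases "?f' c = 0\<^sub>v k")
      case True
      then show ?thesis
        using inj_onD[OF C(2), of c "0\<^sub>v n"] c subspaceD(2)[OF C(1)] linmap_zero[OF h L'] by simp
    next
      case False
      let ?L = "adjoin (\<lambda>x. x) {0\<^sub>v n} c"
      note line = colrank_line[OF h G' cC False]
      have "inj_on ?f ?L"
        using indep[OF line(1,3)] colrank_indep_iff[OF h G line(1)] by blast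
      then show ?thesis
        using inj_onD[of ?f ?L c "0\<^sub>v n"] line(2) subspaceD(2)[OF line(1)] linmap_zero[OF h L] 0 by simp
    qed
  qed
  \<comment> \<open>The lift of \<open>U\<close> to the transversal: \<open>colmap h G'\<close> maps
    \<open>V U\<close> bijectively onto \<open>U\<close>, and \<open>V U\<close> is independent for
    \<open>G'\<close> exactly because \<open>U\<close> keeps its dimension.\<close>
  define V where "V U = {c \<in> C. ?f' c \<in> U}" for U
  have VC: "V U \<subseteq> C" for U by (auto simp: V_def)
  have V: "V U \<in> subspaces n" "?f' ` V U = U" "?f ` V U \<in> dim_preserved_subspaces h G"
    if "U \<in> dim_preserved_subspaces h G'" for U
  proof -
    have U: "U \<in> hsubspaces h k" "U \<subseteq> ?f' ` C" "hdim h k U = sdim k (gspan k U)"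
      using that C(3) by (simp_all add: mem_dim_preserved_subspaces[OF h G'])
    show Vs: "V U \<in> subspaces n" unfolding V_def by (rule linmap_vimage[OF h L' U(1) C(1)])
    show im: "?f' ` V U = U" using U(2) by (auto simp: V_def)
    have "colrank h G' (V U) = sdim n (V U)"
      unfolding colrank_indep_iff[OF h G' Vs]
      using inj_on_subset[OF C(2) VC] U(3) G' by (simp add: im colrank_def)
    then have "colrank h G (V U) = sdim n (V U)" by (rule indep[OF Vs])
    then have "colrank h G (V U) = hdim h k (?f ` V U)"
      using colrank_indep_iff[OF h G Vs] by blast
    then show "?f ` V U \<in> dim_preserved_subspaces h G"
      using linmap_image[OF h L Vs] subspaceD(1)[OF Vs] G
      by (simp add: mem_dim_preserved_subspaces[OF h G] colrank_def image_mono)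
  qed
  have "inj_on (\<lambda>U. ?f ` V U) (dim_preserved_subspaces h G')"
  proof (rule inj_onI)
    fix U W assume UW: "U \<in> dim_preserved_subspaces h G'" "W \<in> dim_preserved_subspaces h G'"
      and "?f ` V U = ?f ` V W"
    \<comment> \<open>Injectivity of \<open>?f\<close> on \<open>C\<close> recovers the lift from
      its image, and the lift determines \<open>U\<close>.\<close>
    then have "?f' ` V U = ?f' ` V W" using inj_on_image_eq_iff[OF inj VC VC] by blast
    then show "U = W" unfolding V(2)[OF UW(1)] V(2)[OF UW(2)] .
  qed
  moreover have "(\<lambda>U. ?f ` V U) ` dim_preserved_subspaces h G' \<subseteq> dim_preserved_subspaces h G"
    using V(3) by blast
  moreover have "dim_preserved_subspaces h G \<subseteq> Pow (carrier_vec k)"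
    using mem_dim_preserved_subspaces[OF h G] hsubspaceD(1)[OF h] by blast
  then have "finite (dim_preserved_subspaces h G)"
    by (rule finite_subset) (simp add: finite_carrier_vec)
  ultimately show ?thesis by (rule card_inj_on_le)
qed

text \<open>Both conditions of \<open>qindepI\<close> come from the diagonal blocks. The fibre
  embeds as a subspace of the independent \<open>I\<close>, and \<open>I\<close> lies in the
  cylinder over its projection, whose column rank is \<open>k1\<close> plus the rank of the
  projection. So the conclusion holds for every \<open>X\<close>.\<close>

lemma (in free_product) qindep_block_upper:
  fixes h :: "'q \<Rightarrow> 'k::{field,finite}"
  assumes h: "field_hom h"
    and G: "G1 \<in> carrier_mat k1 n1" "G2 \<in> carrier_mat k2 n2" "X \<in> carrier_mat k1 n2"
    and r1: "\<And>A. A \<in> subspaces n1 \<Longrightarrow> r1 A = int (colrank h G1 A)"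
    and r2: "\<And>A. A \<in> subspaces n2 \<Longrightarrow> r2 A = int (colrank h G2 A)"
    and k1: "colrank h G1 (carrier_vec n1) = k1"
    and I: "I \<in> subspaces (n1 + n2)" "colrank h (block_upper G1 X G2) I = sdim (n1 + n2) I"
  shows "qindep (n1 + n2) r I"
proof (rule qindepI[OF I(1)])
  let ?B = "block_upper G1 X G2"
  note B = block_upper_carrier[OF G]
  let ?F = "fiber1 n1 n2 I" and ?P = "(\<lambda>v. vec_last v n2) ` I"
  have F: "?F \<in> subspaces n1" by (rule fiber1_subspace[OF I(1)])
  have "emb1 n2 ` ?F \<subseteq> I" by (auto simp: emb1_fiber1[OF I(1)])
  from colrank_indep_subset[OF h B I linmap_image_subspace[OF linmap_emb1 F] this]
  show "qindep n1 r1 ?F"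
    using F by (simp add: qindep_def r1 colrank_block_emb1[OF h G F] sdim_emb1)
  have P: "?P \<in> subspaces n2" by (rule linmap_image_subspace[OF linmap_vec_last I(1)])
  note cyl = cylinder_subspace[OF P, of n1]
  have sub: "I \<subseteq> cylinder n1 n2 ?P" using subspaceD(1)[OF I(1)] by (auto simp: cylinder_def)
  have C: "colmap h ?B ` cylinder n1 n2 ?P \<subseteq> carrier_vec (k1 + k2)"
    using colmap_carrier[OF h B] subspaceD(1)[OF cyl] by blast
  then have C': "colmap h ?B ` I \<subseteq> carrier_vec (k1 + k2)" using sub by blast
  have "colrank h ?B I \<le> colrank h ?B (cylinder n1 n2 ?P)"
    unfolding colrank_def using B
    by (simp add: sdim_mono gspan_subspace C C' gspan_mono image_mono sub)
  then show "int (sdim (n1 + n2) I) \<le> r1 (carrier_vec n1) + r2 ?P"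
    using I(2) by (simp add: colrank_block_cylinder[OF h G k1 P] r1[OF carrier_subspace] r2[OF P] k1)
qed

section \<open>Recovering the factors and comparing upper right blocks\<close>

theorem proposition5p5:
  fixes h :: "'q::{field,finite} \<Rightarrow> 'k::{field,finite}"
    and m n1 n2 k1 k2 :: nat
    and r1 r2 r :: "'q vec set \<Rightarrow> int"
  assumes "field_hom h" and "card (UNIV :: 'k set) = card (UNIV :: 'q set) ^ m"
    and "qmatroid n1 r1" and "qrank n1 r1 = int k1"
    and "qmatroid n2 r2" and "qrank n2 r2 = int k2"
    and "is_free_product n1 n2 r1 r2 r"
    and "representable h (n1 + n2) r"
  shows "representable h n1 r1 \<and> representable h n2 r2 \<and>
    (\<exists>G1 G2 X. represents h k1 n1 G1 r1 \<and> represents h k2 n2 G2 r2 \<and> X \<in> carrier_mat k1 n2 \<and>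
       qmatroid_eq (n1 + n2) r (matrix_qmatroid h (block_upper G1 X G2)) \<and>
       (\<forall>X' \<in> carrier_mat k1 n2.
          card (dim_preserved_subspaces h (block_upper G1 X' G2))
            \<le> card (dim_preserved_subspaces h (block_upper G1 X G2))))"
proof -
  note h = assms(1)
  interpret free_product n1 n2 r1 r2 r by unfold_locales fact+
  have r1k: "r1 (carrier_vec n1) = int k1" and r2k: "r2 (carrier_vec n2) = int k2"
    using assms(4,6) by (simp_all add: qrank_def)
  obtain k G where k: "int k = qrank (n1 + n2) r" and "represents h k (n1 + n2) G r"
    using assms(8) unfolding representable_def by blast
  then have G: "G \<in> carrier_mat k (n1 + n2)" and eqG: "qmatroid_eq (n1 + n2) r (matrix_qmatroid h G)"
    by (simp_all add: represents_def)
  have rG: "r U = int (colrank h G U)" if "U \<in> subspaces (n1 + n2)" for U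
    using matrix_qmatroid_eq_colrank[OF h, of U G] that eqG G by (simp add: qmatroid_eq_def)
  note E1 = linmap_image_subspace[OF linmap_emb1 carrier_subspace, of n2 n1]
  have e1: "colrank h G (emb1 n2 ` carrier_vec n1) = k1"
    using rG[OF E1] rank_emb1[OF carrier_subspace] r1k by simp
  obtain k2' G1 X G2 where kk: "k = k1 + k2'"
    and Gs': "G1 \<in> carrier_mat k1 n1" "G2 \<in> carrier_mat k2' n2" "X \<in> carrier_mat k1 n2"
    and same: "\<forall>U\<in>subspaces (n1 + n2). colrank h (block_upper G1 X G2) U = colrank h G U"
    by (rule block_upper_form[OF h G e1])
  \<comment> \<open>The whole space is the cylinder over \<open>E\<^sub>2\<close>, so its rank is
    \<open>k1 + k2\<close>. This fixes the height of the lower block as \<open>k2\<close>.\<close>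
  have "cylinder n1 n2 (carrier_vec n2 :: 'q vec set) = carrier_vec (n1 + n2)" by (auto simp: cylinder_def)
  then have "int k = int k1 + int k2"
    using rank_cylinder[OF carrier_subspace] k by (simp add: qrank_def r1k r2k)
  then have [simp]: "k2' = k2" using kk by simp
  note Gs = Gs'[simplified]
  let ?B = "block_upper G1 X G2"
  note B = block_upper_carrier[OF Gs]
  have rB: "r U = int (colrank h ?B U)" if "U \<in> subspaces (n1 + n2)" for U
    using rG[OF that] same that by simp
  have r1: "r1 A = int (colrank h G1 A)" if A: "A \<in> subspaces n1" for A
    using rB[OF linmap_image_subspace[OF linmap_emb1 A]] rank_emb1[OF A] colrank_block_emb1[OF h Gs A]
    by simp
  \<comment> \<open>This has to precede the formula for \<open>r2\<close>: the rank of a cylinder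
    splits off \<open>k1\<close> under the condition that \<open>G1\<close> has full rank.\<close>
  have full: "colrank h G1 (carrier_vec n1) = k1" using r1[OF carrier_subspace] r1k by simp
  have r2: "r2 A = int (colrank h G2 A)" if A: "A \<in> subspaces n2" for A
    using rB[OF cylinder_subspace[OF A]] rank_cylinder[OF A] colrank_block_cylinder[OF h Gs full A] r1k
    by simp
  have rep1: "represents h k1 n1 G1 r1"
    using Gs(1) full rank_eq_colrank[OF h Gs(1)] r1
    by (auto simp: represents_def qmatroid_eq_def matrix_qmatroid_eq_colrank[OF h])
  have full2: "colrank h G2 (carrier_vec n2) = k2" using r2[OF carrier_subspace] r2k by simp
  have rep2: "represents h k2 n2 G2 r2"
    using Gs(2) full2 rank_eq_colrank[OF h Gs(2)] r2
    by (auto simp: represents_def qmatroid_eq_def matrix_qmatroid_eq_colrank[OF h])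
  have repB: "qmatroid_eq (n1 + n2) r (matrix_qmatroid h ?B)"
    using B rB by (auto simp: qmatroid_eq_def matrix_qmatroid_eq_colrank[OF h])
  \<comment> \<open>A space independent for \<open>X'\<close> is independent in the free product,
    which is represented by the matrix with \<open>X\<close>. So the chosen \<open>X\<close> has
    every independent space that any other \<open>X'\<close> has, and the count is monotone in
    these.\<close>
  have "card (dim_preserved_subspaces h (block_upper G1 X' G2)) \<le> card (dim_preserved_subspaces h ?B)"
    if X': "X' \<in> carrier_mat k1 n2" for X'
  proof (rule card_dim_preserved_subspaces_mono[OF h B block_upper_carrier[OF Gs(1,2) X']])
    fix I assume I: "I \<in> subspaces (n1 + n2)"
      "colrank h (block_upper G1 X' G2) I = sdim (n1 + n2) I"
    have "qindep (n1 + n2) r I"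
      by (rule qindep_block_upper[OF h Gs(1,2) X' r1 r2 full I])
    then show "colrank h ?B I = sdim (n1 + n2) I" using rB[OF I(1)] by (simp add: qindep_def)
  qed
  moreover have "representable h n1 r1" "representable h n2 r2"
    using rep1 rep2 assms(4,6) unfolding representable_def by metis+
  ultimately show ?thesis using rep1 rep2 Gs(3) repB by blast
qed

end
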